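(* Let $G$ be a finite group and let $L$ be an involutive antiautomorphism of $G$ such that $L(g)$ is conjugate to $g$ for all $g\in G$. Let $L^\ast:L^2(G)\to L^2(G)$, $L^\ast(f)=f\circ L$. Then for all $g\in G$ $$\mathrm{Tr}(\rho_g\circ L^\ast)=\sum_{1\le k\le r}\Big(\frac{1}{|G|}\sum_{h\in G}\chi_k(L(h)h^{-1})\Big)\chi_k(g).$$
   Context: $L^2(G)$ is the complex vector space of all functions $G\to\mathbb{C}$, and $\rho$ is the right regular representation: $(\rho_g f)(h)=f(hg)$. An involutive antiautomorphism of $G$ is a bijection $L:G\to G$ with $L(gh)=L(h)L(g)$ and $L(L(g))=g$ for all $g,h\in G$. $\chi_1,\dots,\chi_r$ are the irreducible complex characters of $G$, each listed once. *)

theory Defs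
  imports "HOL-Algebra.Group" "HOL-Library.Function_Algebras"
    "HOL-Library.FuncSet" Complex_Main
begin

definition scaleF :: "complex \<Rightarrow> ('b \<Rightarrow> complex) \<Rightarrow> 'b \<Rightarrow> complex"
  where "scaleF c f = (\<lambda>x. c * f x)"

interpretation fvs: vector_space "scaleF :: complex \<Rightarrow> ('b \<Rightarrow> complex) \<Rightarrow> 'b \<Rightarrow> complex"
  by unfold_locales (auto simp: scaleF_def algebra_simps)

definition linear_operator_on ::
    "('b \<Rightarrow> complex) set \<Rightarrow> (('b \<Rightarrow> complex) \<Rightarrow> ('b \<Rightarrow> complex)) \<Rightarrow> bool"
  where "linear_operator_on V T \<longleftrightarrow>
    (\<forall>u\<in>V. T u \<in> V) \<and>
    (\<forall>u\<in>V. \<forall>v\<in>V. T (u + v) = T u + T v) \<and>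
    (\<forall>c. \<forall>u\<in>V. T (scaleF c u) = scaleF c (T u))"

definition basis_of :: "('b \<Rightarrow> complex) set \<Rightarrow> ('b \<Rightarrow> complex) set \<Rightarrow> bool"
  where "basis_of V B \<longleftrightarrow> fvs.independent B \<and> fvs.span B = V"

definition finite_dim_subspace :: "('b \<Rightarrow> complex) set \<Rightarrow> bool"
  where "finite_dim_subspace V \<longleftrightarrow> (\<exists>B. finite B \<and> fvs.span B = V)"

text \<open>The summand is the diagonal entry at \<open>b\<close> of the matrix of \<open>T\<close> in the basis \<open>B\<close> of \<open>V\<close>.
  The choice of \<open>B\<close> is irrelevant by \<open>operator_trace_eq\<close> below.\<close>

definition operator_trace ::
    "('b \<Rightarrow> complex) set \<Rightarrow> (('b \<Rightarrow> complex) \<Rightarrow> ('b \<Rightarrow> complex)) \<Rightarrow> complex"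
  where "operator_trace V T =
    (let B = (SOME B. basis_of V B) in \<Sum>b\<in>B. fvs.representation B (T b) b)"

lemma basis_of_finite:
  assumes "finite_dim_subspace V" "basis_of V B"
  shows "finite B"
proof -
  obtain S where "finite S" "fvs.span S = V"
    using assms(1) by (auto simp: finite_dim_subspace_def)
  moreover have "B \<subseteq> V"
    using assms(2) fvs.span_superset by (auto simp: basis_of_def)
  ultimately show ?thesis
    using fvs.independent_span_bound[of S B] assms(2) by (auto simp: basis_of_def)
qed

lemma sum_basis_change:
  assumes T: "linear_operator_on V T" and V: "finite_dim_subspace V"
    and B: "basis_of V B" and C: "basis_of V C"
  shows "(\<Sum>b\<in>B. fvs.representation B (T b) b) = (\<Sum>c\<in>C. fvs.representation C (T c) c)"
proof -
  have fin: "finite B" "finite C"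
    using basis_of_finite V B C by auto
  have iB: "fvs.independent B" "fvs.span B = V" and iC: "fvs.independent C" "fvs.span C = V"
    using B C by (auto simp: basis_of_def)
  have sub: "fvs.subspace V"
    using iB(2) fvs.subspace_span by blast
  have BV: "b \<in> V" if "b \<in> B" for b
    using that iB(2) fvs.span_base by blast
  have CV: "c \<in> V" if "c \<in> C" for c
    using that iC(2) fvs.span_base by blast
  have TV: "T v \<in> V" if "v \<in> V" for v
    using T that by (auto simp: linear_operator_on_def)
  have Tadd: "T (u + v) = T u + T v" if "u \<in> V" "v \<in> V" for u v
    using T that by (auto simp only: linear_operator_on_def)
  have Tscale: "T (scaleF c u) = scaleF c (T u)" if "u \<in> V" for c u
    using T that by (auto simp only: linear_operator_on_def)
  have expand: "v = (\<Sum>x\<in>X. scaleF (fvs.representation X v x) x)"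
    if "fvs.independent X" "fvs.span X = V" "finite X" "v \<in> V" for X and v :: "'a \<Rightarrow> complex"
    using fvs.sum_representation_eq[OF that(1) _ that(3) order_refl] that by simp
  have T0: "T 0 = 0"
  proof -
    have "T (0 + 0) = T 0 + T 0"
      using T fvs.subspace_0[OF sub] unfolding linear_operator_on_def by blast
    then show ?thesis by simp
  qed
  have Tsum: "T (\<Sum>x\<in>X. scaleF (a x) x) = (\<Sum>x\<in>X. scaleF (a x) (T x))"
    if "finite X" "X \<subseteq> V" for X a
    using that
  proof (induction X)
    case empty
    show ?case by (simp only: sum.empty T0)
  next
    case (insert x X)
    have xV: "x \<in> V" and XV: "X \<subseteq> V"
      using insert.prems by auto
    have "(\<Sum>x\<in>X. scaleF (a x) x) \<in> V" "scaleF (a x) x \<in> V"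
      using xV XV sub by (auto intro!: fvs.subspace_sum fvs.subspace_scale)
    then have "T (scaleF (a x) x + (\<Sum>x\<in>X. scaleF (a x) x))
        = scaleF (a x) (T x) + T (\<Sum>x\<in>X. scaleF (a x) x)"
      by (simp only: Tadd Tscale xV)
    also have "T (\<Sum>x\<in>X. scaleF (a x) x) = (\<Sum>x\<in>X. scaleF (a x) (T x))"
      by (rule insert.IH[OF XV])
    finally show ?case
      by (simp only: sum.insert[OF insert.hyps])
  qed
  have rep_sum: "fvs.representation X (\<Sum>y\<in>Y. scaleF (a y) (f y)) z
      = (\<Sum>y\<in>Y. a y * fvs.representation X (f y) z)"
    if "fvs.independent X" "fvs.span X = V" "\<And>y. y \<in> Y \<Longrightarrow> f y \<in> V"
    for X Y a z and f :: "('a \<Rightarrow> complex) \<Rightarrow> ('a \<Rightarrow> complex)"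
    using that
    by (subst fvs.representation_sum)
       (auto simp: fvs.representation_scale intro!: fvs.span_scale)
  have "(\<Sum>b\<in>B. fvs.representation B (T b) b)
      = (\<Sum>b\<in>B. \<Sum>c\<in>C. fvs.representation C b c * fvs.representation B (T c) b)"
  proof (rule sum.cong[OF refl])
    fix b assume b: "b \<in> B"
    have "T b = T (\<Sum>c\<in>C. scaleF (fvs.representation C b c) c)"
      using expand[OF iC fin(2) BV[OF b]] by simp
    also have "\<dots> = (\<Sum>c\<in>C. scaleF (fvs.representation C b c) (T c))"
      using Tsum[OF fin(2)] CV by blast
    finally show "fvs.representation B (T b) b
        = (\<Sum>c\<in>C. fvs.representation C b c * fvs.representation B (T c) b)"
      using rep_sum[OF iB, of C T] CV TV by simp
  qed
  also have "\<dots> = (\<Sum>c\<in>C. \<Sum>b\<in>B. fvs.representation B (T c) b * fvs.representation C b c)"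
    by (subst sum.swap) (simp add: mult.commute)
  also have "\<dots> = (\<Sum>c\<in>C. fvs.representation C (T c) c)"
  proof (rule sum.cong[OF refl])
    fix c assume c: "c \<in> C"
    have "fvs.representation C (T c) c
        = fvs.representation C (\<Sum>b\<in>B. scaleF (fvs.representation B (T c) b) b) c"
      using expand[OF iB fin(1) TV[OF CV[OF c]]] by simp
    also have "\<dots> = (\<Sum>b\<in>B. fvs.representation B (T c) b * fvs.representation C b c)"
      by (rule rep_sum[OF iC]) (rule BV)
    finally show "(\<Sum>b\<in>B. fvs.representation B (T c) b * fvs.representation C b c)
        = fvs.representation C (T c) c" ..
  qed
  finally show ?thesis .
qed

lemma operator_trace_eq:
  assumes "linear_operator_on V T" "finite_dim_subspace V" "basis_of V B"
  shows "operator_trace V T = (\<Sum>b\<in>B. fvs.representation B (T b) b)"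
  unfolding operator_trace_def Let_def
  using sum_basis_change[OF assms(1,2) _ assms(3)] someI[of "basis_of V", OF assms(3)] by blast

definition representation_on ::
    "('a, 'm) monoid_scheme \<Rightarrow> ('b \<Rightarrow> complex) set
      \<Rightarrow> ('a \<Rightarrow> ('b \<Rightarrow> complex) \<Rightarrow> ('b \<Rightarrow> complex)) \<Rightarrow> bool"
  where "representation_on G V R \<longleftrightarrow>
    finite_dim_subspace V \<and>
    (\<forall>g\<in>carrier G. linear_operator_on V (R g)) \<and>
    (\<forall>v\<in>V. R \<one>\<^bsub>G\<^esub> v = v) \<and>
    (\<forall>g\<in>carrier G. \<forall>h\<in>carrier G. \<forall>v\<in>V. R (g \<otimes>\<^bsub>G\<^esub> h) v = R g (R h v))"

definition irreducible_representation_on ::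
    "('a, 'm) monoid_scheme \<Rightarrow> ('b \<Rightarrow> complex) set
      \<Rightarrow> ('a \<Rightarrow> ('b \<Rightarrow> complex) \<Rightarrow> ('b \<Rightarrow> complex)) \<Rightarrow> bool"
  where "irreducible_representation_on G V R \<longleftrightarrow>
    representation_on G V R \<and> V \<noteq> {0} \<and>
    (\<forall>W. fvs.subspace W \<and> W \<subseteq> V \<and> (\<forall>g\<in>carrier G. \<forall>w\<in>W. R g w \<in> W)
      \<longrightarrow> W = {0} \<or> W = V)"

definition character_of ::
    "('a, 'm) monoid_scheme \<Rightarrow> ('b \<Rightarrow> complex) set
      \<Rightarrow> ('a \<Rightarrow> ('b \<Rightarrow> complex) \<Rightarrow> ('b \<Rightarrow> complex)) \<Rightarrow> 'a \<Rightarrow> complex"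
  where "character_of G V R = (\<lambda>g\<in>carrier G. operator_trace V (R g))"

text \<open>Every finite-dimensional complex vector space is isomorphic to a subspace of
  \<open>nat \<Rightarrow> complex\<close>, so quantifying over subspaces of this one space captures the characters
  of all finite-dimensional irreducible representations. Characters are \<open>undefined\<close> off
  \<open>carrier G\<close>, so that equality of characters is equality on \<open>carrier G\<close>.\<close>

definition irreducible_characters :: "('a, 'm) monoid_scheme \<Rightarrow> ('a \<Rightarrow> complex) set"
  where "irreducible_characters G =
    {character_of G V R | (V :: (nat \<Rightarrow> complex) set) R. irreducible_representation_on G V R}"

text \<open>Functions on \<open>carrier G\<close> are represented by their extension by zero.\<close>

definition L2 :: "('a, 'm) monoid_scheme \<Rightarrow> ('a \<Rightarrow> complex) set"
  where "L2 G = {f. \<forall>x. x \<notin> carrier G \<longrightarrow> f x = 0}"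

definition right_regular ::
    "('a, 'm) monoid_scheme \<Rightarrow> 'a \<Rightarrow> ('a \<Rightarrow> complex) \<Rightarrow> ('a \<Rightarrow> complex)"
  where "right_regular G g f = (\<lambda>h. if h \<in> carrier G then f (h \<otimes>\<^bsub>G\<^esub> g) else 0)"

definition pullback ::
    "('a, 'm) monoid_scheme \<Rightarrow> ('a \<Rightarrow> 'a) \<Rightarrow> ('a \<Rightarrow> complex) \<Rightarrow> ('a \<Rightarrow> complex)"
  where "pullback G L f = (\<lambda>h. if h \<in> carrier G then f (L h) else 0)"

definition involutive_antiautomorphism ::
    "('a, 'm) monoid_scheme \<Rightarrow> ('a \<Rightarrow> 'a) \<Rightarrow> bool"
  where "involutive_antiautomorphism G L \<longleftrightarrow>
    bij_betw L (carrier G) (carrier G) \<and>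
    (\<forall>g\<in>carrier G. \<forall>h\<in>carrier G. L (g \<otimes>\<^bsub>G\<^esub> h) = L h \<otimes>\<^bsub>G\<^esub> L g) \<and>
    (\<forall>g\<in>carrier G. L (L g) = g)"

definition conjugate_in :: "('a, 'm) monoid_scheme \<Rightarrow> 'a \<Rightarrow> 'a \<Rightarrow> bool"
  where "conjugate_in G a b \<longleftrightarrow> (\<exists>x\<in>carrier G. a = x \<otimes>\<^bsub>G\<^esub> b \<otimes>\<^bsub>G\<^esub> inv\<^bsub>G\<^esub> x)"

end

(* The trace counts the h with L(hg) = h, that is, the fibre of h |-> h^-1 L(h) over g. The
   substitution h |-> k h L(k) conjugates h^-1 L(h) by L(k), so this count is a class function and
   equals its expansion in irreducible characters; the coefficients are read off by summing over
   the fibres.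
   The expansion of class functions rests on Schur orthogonality and on the following completeness
   argument, which avoids Maschke's theorem. If a class function c is orthogonal to all characters,
   the operator A = sum_x c(x) R(x) vanishes on every irreducible representation. On the regular
   representation A is normal; if it were nonzero, its image would contain an irreducible W, and W
   would lie both in the kernel and in the image of A, which are orthogonal. *)

theory Submission
  imports Defs "HOL-Computational_Algebra.Fundamental_Theorem_Algebra"
begin

text \<open>\<open>irreducible_characters\<close> ranges only over representations on subspaces of
  \<open>nat \<Rightarrow> complex\<close>. The irreducible subspace W of the completeness argument
  must live in that space, so the regular representation is rebuilt there by numbering the group
  elements. The operator A is normal because c is a class function: A commutes with every R(h),
  hence with its adjoint, which is a combination of the R(x^-1). Orthogonality is stated with
  \<phi>(x^-1) in place of a complex conjugate, the form that averaging over the group yields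
  directly; this is why the coefficients of a class function t pair t(x^-1) with \<phi>(x). The
  scalar form of Schur's lemma rests on an eigenvector, found by factoring a polynomial that
  annihilates a vector. Traces enter mainly through cyclicity and through rank-one operators u |->
  \<phi>(u) w, whose trace is \<phi>(w).\<close>

definition linear_map_on ::
    "('b \<Rightarrow> complex) set \<Rightarrow> ('c \<Rightarrow> complex) set \<Rightarrow> (('b \<Rightarrow> complex) \<Rightarrow> ('c \<Rightarrow> complex)) \<Rightarrow> bool"
  where "linear_map_on V W T \<longleftrightarrow>
    (\<forall>u\<in>V. T u \<in> W) \<and>
    (\<forall>u\<in>V. \<forall>v\<in>V. T (u + v) = T u + T v) \<and>
    (\<forall>c. \<forall>u\<in>V. T (scaleF c u) = scaleF c (T u))"

text \<open>Intertwiners need distinct domain and codomain, traces are stated for operators on one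
  space; this lets the facts about \<open>linear_map_on\<close> serve both.\<close>

lemma linear_operator_on_iff: "linear_operator_on V T \<longleftrightarrow> linear_map_on V V T"
  unfolding linear_operator_on_def linear_map_on_def ..

lemma linear_map_onI:
  assumes "\<And>u. u \<in> V \<Longrightarrow> T u \<in> W"
    and "\<And>u v. u \<in> V \<Longrightarrow> v \<in> V \<Longrightarrow> T (u + v) = T u + T v"
    and "\<And>c u. u \<in> V \<Longrightarrow> T (scaleF c u) = scaleF c (T u)"
  shows "linear_map_on V W T"
  unfolding linear_map_on_def using assms by blast

lemma linear_map_onD:
  assumes "linear_map_on V W T"
  shows "u \<in> V \<Longrightarrow> T u \<in> W"
    and "u \<in> V \<Longrightarrow> v \<in> V \<Longrightarrow> T (u + v) = T u + T v"
    and "u \<in> V \<Longrightarrow> T (scaleF c u) = scaleF c (T u)"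
  using assms unfolding linear_map_on_def by blast+

lemma linear_map_on_zero:
  assumes "linear_map_on V W T" "fvs.subspace V"
  shows "T 0 = 0"
  using linear_map_onD(2)[OF assms(1), of 0 0] fvs.subspace_0[OF assms(2)] by simp

lemma linear_map_on_diff:
  assumes "linear_map_on V W T" "fvs.subspace V" "u \<in> V" "v \<in> V"
  shows "T (u - v) = T u - T v"
  using linear_map_onD(2)[OF assms(1), of "u - v" v] fvs.subspace_diff[OF assms(2-4)] assms(4)
  by simp

lemma linear_map_on_sum:
  assumes T: "linear_map_on V W T" and V: "fvs.subspace V" and v: "\<And>i. i \<in> I \<Longrightarrow> v i \<in> V"
  shows "T (\<Sum>i\<in>I. scaleF (a i) (v i)) = (\<Sum>i\<in>I. scaleF (a i) (T (v i)))"
  using v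
proof (induction I rule: infinite_finite_induct)
  case (infinite I)
  \<comment> \<open>Both sums default to 0 for infinite \<open>I\<close>, which leaves
    \<open>T 0 = 0\<close>.\<close>
  show ?case by (simp only: sum.infinite[OF infinite(1)] linear_map_on_zero[OF T V])
next
  case empty
  show ?case by (simp only: sum.empty linear_map_on_zero[OF T V])
next
  case (insert i I)
  have "scaleF (a i) (v i) \<in> V" "(\<Sum>i\<in>I. scaleF (a i) (v i)) \<in> V"
    using insert.prems by (auto intro!: fvs.subspace_sum[OF V] fvs.subspace_scale[OF V])
  then have "T (scaleF (a i) (v i) + (\<Sum>i\<in>I. scaleF (a i) (v i)))
      = scaleF (a i) (T (v i)) + T (\<Sum>i\<in>I. scaleF (a i) (v i))"
    using insert.prems by (simp only: linear_map_onD[OF T] insertI1)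
  then show ?case
    using insert.IH insert.prems by (simp only: sum.insert[OF insert.hyps] insertI2)
qed

lemma linear_map_on_compose:
  "linear_map_on U V S \<Longrightarrow> linear_map_on V W T \<Longrightarrow> linear_map_on U W (T \<circ> S)"
  unfolding linear_map_on_def by simp

text \<open>Covers the class operators and, with all coefficients 1, the averages over the
  group.\<close>

lemma linear_map_on_combination:
  assumes "\<And>i. i \<in> I \<Longrightarrow> linear_map_on V W (T i)" and W: "fvs.subspace W"
  shows "linear_map_on V W (\<lambda>v. \<Sum>i\<in>I. scaleF (a i) (T i v))"
proof (rule linear_map_onI)
  fix u assume "u \<in> V"
  then show "(\<Sum>i\<in>I. scaleF (a i) (T i u)) \<in> W"
    using assms linear_map_onD(1) by (blast intro!: fvs.subspace_sum[OF W] fvs.subspace_scale[OF W])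
next
  fix u v assume "u \<in> V" "v \<in> V"
  then have "(\<Sum>i\<in>I. scaleF (a i) (T i (u + v)))
      = (\<Sum>i\<in>I. scaleF (a i) (T i u) + scaleF (a i) (T i v))"
    by (intro sum.cong refl) (simp only: linear_map_onD(2)[OF assms(1)] fvs.scale_right_distrib)
  then show "(\<Sum>i\<in>I. scaleF (a i) (T i (u + v)))
      = (\<Sum>i\<in>I. scaleF (a i) (T i u)) + (\<Sum>i\<in>I. scaleF (a i) (T i v))"
    by (simp only: sum.distrib)
next
  fix c u assume "u \<in> V"
  then have "(\<Sum>i\<in>I. scaleF (a i) (T i (scaleF c u)))
      = (\<Sum>i\<in>I. scaleF c (scaleF (a i) (T i u)))"
    by (intro sum.cong refl)
       (simp only: linear_map_onD(3)[OF assms(1)] fvs.scale_scale mult.commute)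
  then show "(\<Sum>i\<in>I. scaleF (a i) (T i (scaleF c u))) = scaleF c (\<Sum>i\<in>I. scaleF (a i) (T i u))"
    by (simp only: fvs.scale_sum_right)
qed

section \<open>Finite-dimensional subspaces and their bases\<close>

lemma finite_dim_subspace_imp_subspace: "finite_dim_subspace V \<Longrightarrow> fvs.subspace V"
  unfolding finite_dim_subspace_def by auto

lemma basis_of_exists:
  assumes "fvs.subspace V"
  obtains B where "basis_of V B"
proof -
  obtain B where "B \<subseteq> V" "fvs.independent B" "V \<subseteq> fvs.span B"
    using fvs.maximal_independent_subset[of V] by blast
  then show thesis
    using that fvs.span_minimal[OF _ assms] unfolding basis_of_def by blast
qed

lemma basis_of_subset: "basis_of V B \<Longrightarrow> B \<subseteq> V"
  unfolding basis_of_def using fvs.span_superset by blast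

lemma basis_of_expand:
  assumes "finite_dim_subspace V" "basis_of V B" "v \<in> V"
  shows "v = (\<Sum>b\<in>B. scaleF (fvs.representation B v b) b)"
  using fvs.sum_representation_eq[of B v B] basis_of_finite[OF assms(1,2)] assms(2,3)
  by (simp add: basis_of_def)

lemma basis_of_card_pos:
  assumes "finite_dim_subspace V" "basis_of V B" "V \<noteq> {0}"
  shows "0 < card B"
  using basis_of_finite[OF assms(1,2)] assms(2,3) by (auto simp: basis_of_def card_gt_0_iff)

lemma finite_dim_subspace_subset:
  assumes V: "finite_dim_subspace V" and W: "fvs.subspace W" "W \<subseteq> V"
  shows "finite_dim_subspace W"
proof -
  obtain S where S: "finite S" "fvs.span S = V"
    using V by (auto simp: finite_dim_subspace_def)
  obtain B where B: "basis_of W B"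
    using basis_of_exists[OF W(1)] .
  then have "finite B"
    using fvs.independent_span_bound[OF S(1), of B] basis_of_subset[OF B] W(2) S(2)
    by (auto simp: basis_of_def)
  then show ?thesis
    using B by (auto simp: basis_of_def finite_dim_subspace_def)
qed

text \<open>A vector of V outside W would enlarge a basis of W to an independent set in V with more
  elements than a basis of V. This turns minimality of dimension into irreducibility.\<close>

lemma subspace_eq_if_dim_eq:
  assumes V: "finite_dim_subspace V" and W: "fvs.subspace W" "W \<subseteq> V"
    and dim: "fvs.dim V \<le> fvs.dim W"
  shows "W = V"
proof (rule ccontr)
  assume "W \<noteq> V"
  then obtain v where v: "v \<in> V" "v \<notin> W"
    using W(2) by blast
  obtain B where B: "basis_of V B"
    using basis_of_exists[OF finite_dim_subspace_imp_subspace[OF V]] .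
  obtain C where C: "basis_of W C"
    using basis_of_exists[OF W(1)] .
  have cards: "card B = fvs.dim V" "card C = fvs.dim W"
    using B C fvs.dim_span_eq_card_independent unfolding basis_of_def by metis+
  have "finite C"
    using basis_of_finite[OF finite_dim_subspace_subset[OF V W] C] .
  moreover have "v \<notin> C"
    using v basis_of_subset[OF C] by blast
  moreover have "fvs.independent (insert v C)"
    using C v fvs.independent_insertI by (auto simp: basis_of_def)
  ultimately have "Suc (card C) \<le> card B"
    using fvs.independent_span_bound[OF basis_of_finite[OF V B], of "insert v C"]
      basis_of_subset[OF C] W(2) v(1) B by (auto simp: basis_of_def)
  then show False
    using cards dim by simp
qed

lemma sum_fun_apply: "(\<Sum>i\<in>I. f i) x = (\<Sum>i\<in>I. f i x)"
  for f :: "'i \<Rightarrow> 'b \<Rightarrow> complex"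
  by (induction I rule: infinite_finite_induct) simp_all

text \<open>The point masses on \<open>S\<close> span. Serves both \<open>L2 G\<close> and the copy
  of the regular representation inside \<open>nat \<Rightarrow> complex\<close>.\<close>

lemma finite_dim_subspace_supported:
  assumes "finite S"
  shows "finite_dim_subspace {u :: 'b \<Rightarrow> complex. \<forall>x. x \<notin> S \<longrightarrow> u x = 0}" (is "finite_dim_subspace ?V")
proof -
  define \<delta> :: "'b \<Rightarrow> 'b \<Rightarrow> complex" where "\<delta> s x = (if x = s then 1 else 0)" for s x
  have "fvs.subspace ?V"
    by (rule fvs.subspaceI) (auto simp: scaleF_def)
  moreover have "\<delta> ` S \<subseteq> ?V"
    by (auto simp: \<delta>_def)
  ultimately have "fvs.span (\<delta> ` S) \<subseteq> ?V"
    using fvs.span_minimal by blast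
  moreover have "u \<in> fvs.span (\<delta> ` S)" if "u \<in> ?V" for u
  proof -
    have "u = (\<Sum>s\<in>S. scaleF (u s) (\<delta> s))"
      using that assms
      by (auto simp: fun_eq_iff sum_fun_apply scaleF_def \<delta>_def if_distrib[of "\<lambda>c. _ * c"] cong: if_cong)
    then show ?thesis
      by (metis (no_types, lifting) fvs.span_sum fvs.span_scale fvs.span_base imageI)
  qed
  ultimately show ?thesis
    unfolding finite_dim_subspace_def using assms by blast
qed

section \<open>Traces\<close>

text \<open>The basis picked by \<open>SOME\<close> depends on \<open>V\<close> alone and lies in
  \<open>V\<close>, so only values on \<open>V\<close> enter the trace.\<close>

lemma operator_trace_cong:
  assumes "fvs.subspace V" "\<And>v. v \<in> V \<Longrightarrow> S v = T v"
  shows "operator_trace V S = operator_trace V T"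
proof -
  have "basis_of V (SOME B. basis_of V B)"
    using basis_of_exists[OF assms(1)] someI_ex by metis
  then have "b \<in> V" if "b \<in> (SOME B. basis_of V B)" for b
    using that basis_of_subset by blast
  then show ?thesis
    unfolding operator_trace_def Let_def by (intro sum.cong refl) (simp only: assms(2))
qed

text \<open>Expanding through bases of both spaces gives the same double sum for either order of
  composition.\<close>

lemma operator_trace_cyclic:
  assumes V: "finite_dim_subspace V" and W: "finite_dim_subspace W"
    and f: "linear_map_on V W f" and g: "linear_map_on W V g"
  shows "operator_trace V (g \<circ> f) = operator_trace W (f \<circ> g)"
proof -
  \<comment> \<open>Stated for arbitrary spaces because it is used twice, with the roles of
    \<open>f\<close> and \<open>g\<close> exchanged.\<close>
  have entry: "fvs.representation B (q (p b)) b
      = (\<Sum>c\<in>C. fvs.representation C (p b) c * fvs.representation B (q c) b)"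
    if "finite_dim_subspace X" "finite_dim_subspace Y" "basis_of X B" "basis_of Y C"
      "linear_map_on X Y p" "linear_map_on Y X q" "b \<in> B"
    for X :: "('x \<Rightarrow> complex) set" and Y :: "('y \<Rightarrow> complex) set" and B C p q b
  proof -
    have CY: "c \<in> Y" if "c \<in> C" for c
      using that basis_of_subset \<open>basis_of Y C\<close> by blast
    have "p b \<in> Y"
      using that basis_of_subset linear_map_onD(1) by blast
    then have "q (p b) = q (\<Sum>c\<in>C. scaleF (fvs.representation C (p b) c) c)"
      using basis_of_expand[OF that(2,4)] by simp
    also have "\<dots> = (\<Sum>c\<in>C. scaleF (fvs.representation C (p b) c) (q c))"
      by (rule linear_map_on_sum[OF that(6) finite_dim_subspace_imp_subspace[OF that(2)] CY])
    finally have eq: "q (p b) = (\<Sum>c\<in>C. scaleF (fvs.representation C (p b) c) (q c))" .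
    have "q c \<in> fvs.span B" if "c \<in> C" for c
      using CY[OF that] linear_map_onD(1)[OF \<open>linear_map_on Y X q\<close>] \<open>basis_of X B\<close>
      by (auto simp: basis_of_def)
    then show ?thesis
      using that(3) unfolding eq
      by (subst fvs.representation_sum)
         (auto simp: basis_of_def fvs.representation_scale intro!: fvs.span_scale)
  qed
  obtain B where B: "basis_of V B"
    using basis_of_exists[OF finite_dim_subspace_imp_subspace[OF V]] .
  obtain C where C: "basis_of W C"
    using basis_of_exists[OF finite_dim_subspace_imp_subspace[OF W]] .
  have "operator_trace V (g \<circ> f)
      = (\<Sum>b\<in>B. \<Sum>c\<in>C. fvs.representation C (f b) c * fvs.representation B (g c) b)"
    using entry[OF V W B C f g] linear_map_on_compose[OF f g]
    by (simp add: operator_trace_eq[OF _ V B] linear_operator_on_iff)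
  also have "\<dots> = (\<Sum>c\<in>C. \<Sum>b\<in>B. fvs.representation B (g c) b * fvs.representation C (f b) c)"
    by (subst sum.swap) (simp add: mult.commute)
  also have "\<dots> = operator_trace W (f \<circ> g)"
    using entry[OF W V C B g f] linear_map_on_compose[OF g f]
    by (simp add: operator_trace_eq[OF _ W C] linear_operator_on_iff)
  finally show ?thesis .
qed

lemma operator_trace_combination:
  assumes V: "finite_dim_subspace V" and T: "\<And>i. i \<in> I \<Longrightarrow> linear_map_on V V (T i)"
  shows "operator_trace V (\<lambda>v. \<Sum>i\<in>I. scaleF (a i) (T i v))
    = (\<Sum>i\<in>I. a i * operator_trace V (T i))"
proof -
  have sub: "fvs.subspace V"
    using finite_dim_subspace_imp_subspace[OF V] .
  obtain B where B: "basis_of V B"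
    using basis_of_exists[OF sub] .
  have "T i b \<in> fvs.span B" if "i \<in> I" "b \<in> B" for i b
    using linear_map_onD(1)[OF T[OF that(1)]] basis_of_subset[OF B] that(2) B
    by (auto simp: basis_of_def)
  then have "fvs.representation B (\<Sum>i\<in>I. scaleF (a i) (T i b)) b
      = (\<Sum>i\<in>I. a i * fvs.representation B (T i b) b)" if "b \<in> B" for b
    using that B by (subst fvs.representation_sum)
       (auto simp: basis_of_def fvs.representation_scale intro!: fvs.span_scale)
  then have "operator_trace V (\<lambda>v. \<Sum>i\<in>I. scaleF (a i) (T i v))
      = (\<Sum>b\<in>B. \<Sum>i\<in>I. a i * fvs.representation B (T i b) b)"
    using linear_map_on_combination[of I V V T, OF T sub]
    by (simp add: operator_trace_eq[OF _ V B] linear_operator_on_iff)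
  also have "\<dots> = (\<Sum>i\<in>I. a i * (\<Sum>b\<in>B. fvs.representation B (T i b) b))"
    by (subst sum.swap) (simp add: sum_distrib_left)
  also have "\<dots> = (\<Sum>i\<in>I. a i * operator_trace V (T i))"
    using T by (intro sum.cong refl) (simp add: operator_trace_eq[OF _ V B] linear_operator_on_iff)
  finally show ?thesis .
qed

lemma operator_trace_scale:
  assumes V: "finite_dim_subspace V" and B: "basis_of V B"
  shows "operator_trace V (scaleF c) = c * of_nat (card B)"
proof -
  have "linear_operator_on V (scaleF c)"
    unfolding linear_operator_on_iff using finite_dim_subspace_imp_subspace[OF V]
    by (intro linear_map_onI)
       (auto simp: fvs.subspace_scale fvs.scale_right_distrib mult.commute)
  moreover have "fvs.representation B (scaleF c b) b = c" if "b \<in> B" for b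
    using that B unfolding basis_of_def
    by (auto simp: fvs.representation_scale fvs.span_base fvs.representation_basis)
  ultimately show ?thesis
    by (simp add: operator_trace_eq[OF _ V B])
qed

section \<open>Linear functionals and rank-one operators\<close>

definition linear_functional_on :: "('b \<Rightarrow> complex) set \<Rightarrow> (('b \<Rightarrow> complex) \<Rightarrow> complex) \<Rightarrow> bool"
  where "linear_functional_on V \<phi> \<longleftrightarrow>
    (\<forall>u\<in>V. \<forall>v\<in>V. \<phi> (u + v) = \<phi> u + \<phi> v) \<and> (\<forall>c. \<forall>u\<in>V. \<phi> (scaleF c u) = c * \<phi> u)"

lemma linear_functional_on_sum:
  assumes \<phi>: "linear_functional_on V \<phi>" and V: "fvs.subspace V" and v: "\<And>i. i \<in> I \<Longrightarrow> v i \<in> V"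
  shows "\<phi> (\<Sum>i\<in>I. scaleF (a i) (v i)) = (\<Sum>i\<in>I. a i * \<phi> (v i))"
proof -
  \<comment> \<open>Scalars are viewed as functions on a one-point type, which makes the functional
    a linear map between function spaces.\<close>
  have "linear_map_on V UNIV (\<lambda>u. \<lambda>_::unit. \<phi> u)"
    using \<phi> by (intro linear_map_onI)
      (auto simp: linear_functional_on_def scaleF_def fun_eq_iff plus_fun_def)
  from linear_map_on_sum[OF this V v]
  have "(\<lambda>_::unit. \<phi> (\<Sum>i\<in>I. scaleF (a i) (v i))) () = (\<Sum>i\<in>I. scaleF (a i) (\<lambda>_::unit. \<phi> (v i))) ()"
    by (rule fun_cong)
  also have "\<dots> = (\<Sum>i\<in>I. a i * \<phi> (v i))"
    by (induction I rule: infinite_finite_induct) (simp_all add: scaleF_def)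
  finally show ?thesis .
qed

lemma linear_functional_on_representation:
  assumes "basis_of V B"
  shows "linear_functional_on V (\<lambda>v. fvs.representation B v b)"
  using assms unfolding linear_functional_on_def basis_of_def
  by (auto simp: fvs.representation_add fvs.representation_scale)

lemma linear_map_on_rank_one:
  assumes "linear_functional_on V \<phi>" "fvs.subspace W" "w \<in> W"
  shows "linear_map_on V W (\<lambda>u. scaleF (\<phi> u) w)"
  using assms by (intro linear_map_onI)
    (auto simp: linear_functional_on_def fvs.subspace_scale fvs.scale_left_distrib)

text \<open>The diagonal entries are the coordinates of \<open>w\<close> times the values of \<phi>
  on the basis, and these reassemble \<phi>(w). Applied to matrix units in the norm computation and
  to the summands of the twisted translation.\<close>

lemma operator_trace_rank_one:
  assumes V: "finite_dim_subspace V" and \<phi>: "linear_functional_on V \<phi>" and w: "w \<in> V"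
  shows "operator_trace V (\<lambda>u. scaleF (\<phi> u) w) = \<phi> w"
proof -
  have sub: "fvs.subspace V"
    using finite_dim_subspace_imp_subspace[OF V] .
  obtain B where B: "basis_of V B"
    using basis_of_exists[OF sub] .
  have "operator_trace V (\<lambda>u. scaleF (\<phi> u) w)
      = (\<Sum>b\<in>B. fvs.representation B (scaleF (\<phi> b) w) b)"
    using linear_map_on_rank_one[OF \<phi> sub w]
    by (simp add: operator_trace_eq[OF _ V B] linear_operator_on_iff)
  also have "\<dots> = (\<Sum>b\<in>B. fvs.representation B w b * \<phi> b)"
    using B w by (intro sum.cong refl) (simp add: basis_of_def fvs.representation_scale)
  also have "\<dots> = \<phi> (\<Sum>b\<in>B. scaleF (fvs.representation B w b) b)"
    using linear_functional_on_sum[OF \<phi> sub, of B "\<lambda>b. b"] basis_of_subset[OF B] by (metis subsetD)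
  also have "\<dots> = \<phi> w"
    using basis_of_expand[OF V B w] by simp
  finally show ?thesis .
qed

section \<open>Eigenvectors\<close>

text \<open>The vector p(T)v. Evaluation at a vector, rather than an operator p(T), suits an
  operator that is controlled only on a subspace.\<close>

definition poly_apply ::
    "complex poly \<Rightarrow> (('b \<Rightarrow> complex) \<Rightarrow> ('b \<Rightarrow> complex)) \<Rightarrow> ('b \<Rightarrow> complex) \<Rightarrow> ('b \<Rightarrow> complex)"
  where "poly_apply p T v = (\<Sum>i\<le>degree p. scaleF (coeff p i) ((T ^^ i) v))"

lemma poly_apply_bound:
  assumes "degree p \<le> n"
  shows "poly_apply p T v = (\<Sum>i\<le>n. scaleF (coeff p i) ((T ^^ i) v))"
  unfolding poly_apply_def using assms
  by (intro sum.mono_neutral_left) (auto simp: coeff_eq_0)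

lemma funpow_in_invariant_subspace:
  assumes "linear_map_on V V T" "v \<in> V"
  shows "(T ^^ i) v \<in> V"
  by (induction i) (use assms linear_map_onD(1) in auto)

lemma poly_apply_mem:
  assumes "linear_map_on V V T" "fvs.subspace V" "v \<in> V"
  shows "poly_apply p T v \<in> V"
  unfolding poly_apply_def using funpow_in_invariant_subspace[OF assms(1,3)]
  by (intro fvs.subspace_sum fvs.subspace_scale assms(2)) auto

lemma poly_apply_linear_factor:
  assumes T: "linear_map_on V V T" and V: "fvs.subspace V" and v: "v \<in> V"
  shows "poly_apply ([:- z, 1:] * q) T v = T (poly_apply q T v) - scaleF z (poly_apply q T v)"
proof -
  let ?n = "degree q"
  have "degree ([:- z, 1:] * q) \<le> Suc ?n"
    using degree_mult_le[of "[:- z, 1:]" q] by simp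
  then have "poly_apply ([:- z, 1:] * q) T v
      = (\<Sum>i\<le>Suc ?n. scaleF (coeff (pCons 0 q) i - z * coeff q i) ((T ^^ i) v))"
    by (subst poly_apply_bound[of _ "Suc ?n"]) (auto simp: algebra_simps)
  also have "\<dots> = (\<Sum>i\<le>Suc ?n. scaleF (coeff (pCons 0 q) i) ((T ^^ i) v))
      - scaleF z (\<Sum>i\<le>Suc ?n. scaleF (coeff q i) ((T ^^ i) v))"
    by (simp only: fvs.scale_left_diff_distrib sum_subtractf fvs.scale_sum_right fvs.scale_scale)
  \<comment> \<open>Multiplication by the variable shifts the coefficients by one: the term at 0
    vanishes and the remaining indices drop back to \<open>degree q\<close>.\<close>
  also have "(\<Sum>i\<le>Suc ?n. scaleF (coeff (pCons 0 q) i) ((T ^^ i) v))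
      = (\<Sum>i\<le>?n. scaleF (coeff q i) (T ((T ^^ i) v)))"
    by (simp only: sum.atMost_Suc_shift coeff_pCons_0 coeff_pCons_Suc fvs.scale_zero_left add_0_left
        funpow.simps o_apply)
  also have "\<dots> = T (poly_apply q T v)"
    unfolding poly_apply_def
    by (rule linear_map_on_sum[OF T V funpow_in_invariant_subspace[OF T v], symmetric])
  finally show ?thesis
    by (simp only: poly_apply_bound[of q "Suc ?n"])
qed

text \<open>Split off a root: p = (X - z) q. If q(T)v is nonzero, it is an eigenvector for z;
  otherwise q annihilates v and has smaller degree. A nonzero constant cannot annihilate the nonzero
  v.\<close>

lemma eigenvector_if_annihilated:
  assumes T: "linear_map_on V V T" and V: "fvs.subspace V" and v: "v \<in> V" "v \<noteq> 0"
    and p: "p \<noteq> 0" "poly_apply p T v = 0"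
  obtains z w where "w \<in> V" "w \<noteq> 0" "T w = scaleF z w"
proof -
  have "\<exists>z w. w \<in> V \<and> w \<noteq> 0 \<and> T w = scaleF z w"
    using p
  proof (induction "degree p" arbitrary: p rule: less_induct)
    case less
    show ?case
    proof (cases "degree p = 0")
      case True
      then have "scaleF (coeff p 0) v = 0" "coeff p 0 \<noteq> 0"
        using less.prems degree_0_id[OF True] by (auto simp: poly_apply_def)
      then show ?thesis
        using v(2) by simp
    next
      case False
      then obtain z where "poly p z = 0"
        using fundamental_theorem_of_algebra[of p] constant_degree[of p] by auto
      then obtain q where q: "p = [:- z, 1:] * q"
        unfolding poly_eq_0_iff_dvd by blast
      then have "q \<noteq> 0"
        using less.prems by auto
      then have "degree q < degree p"
        unfolding q by (subst degree_mult_eq) auto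
      moreover have "T (poly_apply q T v) = scaleF z (poly_apply q T v)"
        using less.prems(2) poly_apply_linear_factor[OF T V v(1)] unfolding q by auto
      ultimately show ?thesis
        using less.hyps[OF _ \<open>q \<noteq> 0\<close>] poly_apply_mem[OF T V v(1)] by blast
    qed
  qed
  then show thesis
    using that by blast
qed

text \<open>The \<open>card S + 1\<close> vectors v, Tv, ..., T^(card S) v lie in the span of
  \<open>card S\<close> vectors, so a linear relation among them gives an annihilating
  polynomial.\<close>

lemma eigenvector_exists:
  assumes T: "linear_map_on V V T" and V: "finite_dim_subspace V" "V \<noteq> {0}"
  obtains z w where "w \<in> V" "w \<noteq> 0" "T w = scaleF z w"
proof -
  have sub: "fvs.subspace V"
    using finite_dim_subspace_imp_subspace[OF V(1)] .
  obtain v where v: "v \<in> V" "v \<noteq> 0"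
    using V(2) fvs.subspace_0[OF sub] by blast
  obtain S where S: "finite S" "fvs.span S = V"
    using V(1) by (auto simp: finite_dim_subspace_def)
  let ?t = "\<lambda>i. (T ^^ i) v"
  have mem: "?t i \<in> V" for i
    using funpow_in_invariant_subspace[OF T v(1)] .
  have "\<exists>p. p \<noteq> 0 \<and> poly_apply p T v = 0"
  \<comment> \<open>Independence is a property of sets, so a repetition among the iterates would be
    lost in the image. It is treated separately, with annihilating polynomial X^i - X^j.\<close>
  proof (cases "inj_on ?t {..card S}")
    case False
    then obtain i j where ij: "i \<le> card S" "j \<le> card S" "i \<noteq> j" "?t i = ?t j"
      by (auto simp: inj_on_def)
    let ?p = "monom 1 i - monom 1 j :: complex poly"
    have p: "?p \<noteq> 0"
      using ij(3) by (simp add: monom_eq_iff')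
    have "degree ?p \<le> card S"
      using ij(1,2) by (intro degree_diff_le) (auto intro: order_trans[OF degree_monom_le])
    then have "poly_apply ?p T v
        = (\<Sum>k\<le>card S. scaleF (if i = k then 1 else 0) (?t k) - scaleF (if j = k then 1 else 0) (?t k))"
      by (simp add: poly_apply_bound fvs.scale_left_diff_distrib)
    then have "poly_apply ?p T v = ?t i - ?t j"
      using ij(1,2) by (simp add: sum_subtractf if_distrib[of "\<lambda>c. scaleF c _"] cong: if_cong)
    then show ?thesis
      using p ij(4) by (metis diff_self)
  next
    case True
    have "\<not> fvs.independent (?t ` {..card S})"
      using fvs.independent_span_bound[OF S(1), of "?t ` {..card S}"] mem S(2) card_image[OF True]
      by auto
    then obtain a where a: "\<exists>u\<in>?t ` {..card S}. a u \<noteq> 0"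
        "(\<Sum>u\<in>?t ` {..card S}. scaleF (a u) u) = 0"
      by (auto simp: fvs.dependent_finite)
    define p where "p = (\<Sum>i\<le>card S. monom (a (?t i)) i)"
    have cp: "coeff p i = (if i \<le> card S then a (?t i) else 0)" for i
      unfolding p_def by (simp add: coeff_sum)
    obtain i where "i \<le> card S" "a (?t i) \<noteq> 0"
      using a(1) by blast
    then have "coeff p i \<noteq> 0"
      by (simp add: cp)
    then have "p \<noteq> 0"
      by auto
    moreover have "degree p \<le> card S"
      using cp by (intro degree_le) auto
    then have "poly_apply p T v = 0"
      using a(2) by (simp add: poly_apply_bound cp sum.reindex[OF True])
    ultimately show ?thesis
      by blast
  qed
  then show thesis
    using eigenvector_if_annihilated[OF T sub v] that by blast
qed


section \<open>Schur's lemma\<close>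

lemma representation_onD:
  assumes "representation_on G V R"
  shows "finite_dim_subspace V" and "fvs.subspace V"
    and "g \<in> carrier G \<Longrightarrow> linear_map_on V V (R g)"
    and "g \<in> carrier G \<Longrightarrow> v \<in> V \<Longrightarrow> R g v \<in> V"
    and "v \<in> V \<Longrightarrow> R \<one>\<^bsub>G\<^esub> v = v"
    and "g \<in> carrier G \<Longrightarrow> h \<in> carrier G \<Longrightarrow> v \<in> V \<Longrightarrow> R (g \<otimes>\<^bsub>G\<^esub> h) v = R g (R h v)"
  using assms finite_dim_subspace_imp_subspace[of V]
  unfolding representation_on_def linear_operator_on_iff by (auto dest: linear_map_onD(1))

lemma irreducible_representation_onD:
  assumes "irreducible_representation_on G V R"
  shows "representation_on G V R" and "V \<noteq> {0}"
    and "fvs.subspace W \<Longrightarrow> W \<subseteq> V \<Longrightarrow> (\<And>g w. g \<in> carrier G \<Longrightarrow> w \<in> W \<Longrightarrow> R g w \<in> W)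
      \<Longrightarrow> W = {0} \<or> W = V"
  using assms unfolding irreducible_representation_on_def by blast+

lemma subspace_linear_map_kernel:
  assumes f: "linear_map_on V W f" and V: "fvs.subspace V"
  shows "fvs.subspace {v \<in> V. f v = 0}"
proof (rule fvs.subspaceI)
  show "0 \<in> {v \<in> V. f v = 0}"
    using linear_map_on_zero[OF f V] fvs.subspace_0[OF V] by blast
next
  fix x y assume "x \<in> {v \<in> V. f v = 0}" "y \<in> {v \<in> V. f v = 0}"
  then show "x + y \<in> {v \<in> V. f v = 0}"
    using linear_map_onD(2)[OF f, of x y] fvs.subspace_add[OF V] by auto
next
  fix c x assume "x \<in> {v \<in> V. f v = 0}"
  then show "scaleF c x \<in> {v \<in> V. f v = 0}"
    using linear_map_onD(3)[OF f, of x c] fvs.subspace_scale[OF V] by auto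
qed

lemma subspace_linear_map_image:
  assumes f: "linear_map_on V W f" and V: "fvs.subspace V"
  shows "fvs.subspace (f ` V)"
proof (rule fvs.subspaceI)
  show "0 \<in> f ` V"
    using linear_map_on_zero[OF f V] fvs.subspace_0[OF V] by force
next
  fix x y assume "x \<in> f ` V" "y \<in> f ` V"
  then obtain u v where "u \<in> V" "v \<in> V" "x = f u" "y = f v"
    by blast
  then show "x + y \<in> f ` V"
    using linear_map_onD(2)[OF f, of u v] fvs.subspace_add[OF V, of u v] by (metis imageI)
next
  fix c x assume "x \<in> f ` V"
  then obtain u where "u \<in> V" "x = f u"
    by blast
  then show "scaleF c x \<in> f ` V"
    using linear_map_onD(3)[OF f, of u c] fvs.subspace_scale[OF V, of u c] by (metis imageI)
qed

text \<open>Kernel and image are invariant, hence trivial or everything; the witness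
  \<open>v\<close> rules out the kernel being \<open>V\<close> and the image being zero. A witness
  in \<open>V\<close> is demanded because \<open>f\<close> is a total function whose values
  elsewhere carry no meaning.\<close>

lemma schur_bijective:
  assumes V: "irreducible_representation_on G V R" and W: "irreducible_representation_on G W S"
    and f: "linear_map_on V W f"
    and comm: "\<And>g v. g \<in> carrier G \<Longrightarrow> v \<in> V \<Longrightarrow> f (R g v) = S g (f v)"
    and nz: "v \<in> V" "f v \<noteq> 0"
  shows "bij_betw f V W"
proof -
  note V' = representation_onD[OF irreducible_representation_onD(1)[OF V]]
  note W' = representation_onD[OF irreducible_representation_onD(1)[OF W]]
  let ?K = "{v \<in> V. f v = 0}"
  have "?K = {0} \<or> ?K = V"
  proof (rule irreducible_representation_onD(3)[OF V])
    fix g w assume "g \<in> carrier G" "w \<in> ?K"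
    then show "R g w \<in> ?K"
      using comm V'(4) linear_map_on_zero[OF W'(3,2)] by auto
  qed (use subspace_linear_map_kernel[OF f V'(2)] in auto)
  then have K: "?K = {0}"
    using nz by blast
  have "inj_on f V"
  proof (rule inj_onI)
    fix u w assume uw: "u \<in> V" "w \<in> V" "f u = f w"
    then have "u - w \<in> ?K"
      using linear_map_on_diff[OF f V'(2)] fvs.subspace_diff[OF V'(2)] by auto
    then show "u = w"
      unfolding K by simp
  qed
  moreover have "f ` V = {0} \<or> f ` V = W"
  proof (rule irreducible_representation_onD(3)[OF W])
    fix g w assume g: "g \<in> carrier G" and "w \<in> f ` V"
    then obtain u where "u \<in> V" "w = f u"
      by blast
    then show "S g w \<in> f ` V"
      using comm[OF g] V'(4)[OF g] by (metis imageI)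
  qed (use subspace_linear_map_image[OF f V'(2)] linear_map_onD(1)[OF f] in auto)
  then have "f ` V = W"
    using nz by blast
  ultimately show ?thesis
    by (simp add: bij_betw_def)
qed

text \<open>With h the inverse of f on \<open>W\<close>, R(g) agrees on \<open>V\<close> with h f
  R(g), and cyclicity moves h to the right: f R(g) h agrees with S(g) on \<open>W\<close>.\<close>

lemma character_of_eq_if_isomorphic:
  assumes V: "representation_on G V R" and W: "representation_on G W S"
    and f: "linear_map_on V W f" and bij: "bij_betw f V W"
    and comm: "\<And>g v. g \<in> carrier G \<Longrightarrow> v \<in> V \<Longrightarrow> f (R g v) = S g (f v)"
  shows "character_of G V R = character_of G W S"
proof -
  note V' = representation_onD[OF V]
  note W' = representation_onD[OF W]
  let ?h = "inv_into V f"
  have hV: "?h w \<in> V" and fh: "f (?h w) = w" if "w \<in> W" for w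
    using that bij by (auto simp: bij_betw_def inv_into_into f_inv_into_f)
  have hf: "?h (f v) = v" if "v \<in> V" for v
    using that bij by (simp add: bij_betw_def)
  have h: "linear_map_on W V ?h"
  proof (rule linear_map_onI)
    fix u v assume uv: "u \<in> W" "v \<in> W"
    then have "f (?h u + ?h v) = u + v"
      by (simp only: linear_map_onD(2)[OF f] hV fh)
    then show "?h (u + v) = ?h u + ?h v"
      using hf[OF fvs.subspace_add[OF V'(2) hV[OF uv(1)] hV[OF uv(2)]]] by simp
  next
    fix c u assume u: "u \<in> W"
    then have "f (scaleF c (?h u)) = scaleF c u"
      by (simp only: linear_map_onD(3)[OF f] hV fh)
    then show "?h (scaleF c u) = scaleF c (?h u)"
      using hf[OF fvs.subspace_scale[OF V'(2) hV[OF u]]] by metis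
  qed (rule hV)
  have "operator_trace V (R g) = operator_trace W (S g)" if g: "g \<in> carrier G" for g
  proof -
    have "operator_trace V (R g) = operator_trace V (?h \<circ> (f \<circ> R g))"
      using hf V'(4)[OF g] by (intro operator_trace_cong V'(2)) simp
    also have "\<dots> = operator_trace W ((f \<circ> R g) \<circ> ?h)"
      by (rule operator_trace_cyclic[OF V'(1) W'(1) linear_map_on_compose[OF V'(3)[OF g] f] h])
    also have "\<dots> = operator_trace W (S g)"
      using comm[OF g] hV fh by (intro operator_trace_cong W'(2)) simp
    finally show ?thesis .
  qed
  then show ?thesis
    unfolding character_of_def by (intro restrict_ext)
qed

text \<open>Let z be an eigenvalue of \<open>f\<close>. Then f - z commutes with the group and kills
  an eigenvector, so it is not injective, and by \<open>schur_bijective\<close> it vanishes on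
  \<open>V\<close>.\<close>

lemma schur_scalar:
  assumes V: "irreducible_representation_on G V R" and f: "linear_map_on V V f"
    and comm: "\<And>g v. g \<in> carrier G \<Longrightarrow> v \<in> V \<Longrightarrow> f (R g v) = R g (f v)"
  obtains z where "\<And>v. v \<in> V \<Longrightarrow> f v = scaleF z v"
proof -
  note V' = representation_onD[OF irreducible_representation_onD(1)[OF V]]
  obtain z w where w: "w \<in> V" "w \<noteq> 0" "f w = scaleF z w"
    using eigenvector_exists[OF f V'(1) irreducible_representation_onD(2)[OF V]] .
  define h where "h v = f v - scaleF z v" for v
  have h: "linear_map_on V V h"
  proof (rule linear_map_onI)
    fix u assume "u \<in> V"
    then show "h u \<in> V"
      using linear_map_onD(1)[OF f] fvs.subspace_diff[OF V'(2)] fvs.subspace_scale[OF V'(2)]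
      unfolding h_def by blast
  next
    fix u v assume "u \<in> V" "v \<in> V"
    then show "h (u + v) = h u + h v"
      using linear_map_onD(2)[OF f] by (simp add: h_def fvs.scale_right_distrib)
  next
    fix c u assume "u \<in> V"
    then show "h (scaleF c u) = scaleF c (h u)"
      using linear_map_onD(3)[OF f] by (simp add: h_def fvs.scale_right_diff_distrib mult.commute)
  qed
  have hcomm: "h (R g v) = R g (h v)" if "g \<in> carrier G" "v \<in> V" for g v
    using that comm linear_map_on_diff[OF V'(3,2), of g "f v" "scaleF z v"]
      linear_map_onD(1)[OF f] linear_map_onD(3)[OF V'(3)] fvs.subspace_scale[OF V'(2)]
    by (simp add: h_def)
  have "h v = 0" if "v \<in> V" for v
  proof (rule ccontr)
    assume "h v \<noteq> 0"
    have "bij_betw h V V"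
      using hcomm that \<open>h v \<noteq> 0\<close> by (intro schur_bijective[OF V V h, where v = v])
    then have "inj_on h V"
      by (rule bij_betw_imp_inj_on)
    moreover have "h w = 0"
      by (simp only: h_def w(3) diff_self)
    then have "h w = h 0"
      by (simp only: linear_map_on_zero[OF h V'(2)])
    ultimately have "w = 0"
      using w(1) fvs.subspace_0[OF V'(2)] by (rule inj_onD)
    then show False
      using w(2) by contradiction
  qed
  then show thesis
    by (intro that[of z]) (simp add: h_def)
qed

text \<open>A nonzero invariant subspace of \<open>U\<close> of least dimension is irreducible; no
  invariant complement has to be constructed.\<close>

lemma irreducible_subrepresentation_exists:
  assumes V: "representation_on G V R"
    and U: "fvs.subspace U" "U \<subseteq> V" "U \<noteq> {0}"
      "\<And>g u. g \<in> carrier G \<Longrightarrow> u \<in> U \<Longrightarrow> R g u \<in> U"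
  obtains W where "W \<subseteq> U" "irreducible_representation_on G W R"
proof -
  let ?P = "\<lambda>W. fvs.subspace W \<and> W \<subseteq> U \<and> W \<noteq> {0} \<and> (\<forall>g\<in>carrier G. \<forall>w\<in>W. R g w \<in> W)"
  have "?P U"
    using U by blast
  then obtain W where W: "?P W" and min: "\<And>X. ?P X \<Longrightarrow> fvs.dim W \<le> fvs.dim X"
    using ex_has_least_nat[of ?P U fvs.dim] by blast
  have fin: "finite_dim_subspace W"
    using finite_dim_subspace_subset[OF representation_onD(1)[OF V]] W U(2) by blast
  have WV: "w \<in> V" if "w \<in> W" for w
    using that W U(2) by blast
  have "linear_map_on W W (R g)" if g: "g \<in> carrier G" for g
  proof (rule linear_map_onI)
    fix u assume "u \<in> W"
    then show "R g u \<in> W"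
      using W g by blast
  qed (simp_all only: linear_map_onD(2,3)[OF representation_onD(3)[OF V g]] WV)
  then have "representation_on G W R"
    unfolding representation_on_def linear_operator_on_iff
    using fin representation_onD(5,6)[OF V] WV by simp
  moreover have "X = {0} \<or> X = W"
    if "fvs.subspace X" "X \<subseteq> W" "\<forall>g\<in>carrier G. \<forall>w\<in>X. R g w \<in> X" for X
    using subspace_eq_if_dim_eq[OF fin that(1,2)] min[of X] W that by blast
  ultimately have "irreducible_representation_on G W R"
    using W unfolding irreducible_representation_on_def by blast
  then show thesis
    using that W by blast
qed

section \<open>Characters\<close>

context group
begin

lemma bij_betw_translate_left: "g \<in> carrier G \<Longrightarrow> bij_betw (\<lambda>x. g \<otimes> x) (carrier G) (carrier G)"
  by (rule bij_betw_byWitness[where f' = "\<lambda>x. inv g \<otimes> x"]) (auto simp: m_assoc[symmetric])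

lemma bij_betw_translate_right: "g \<in> carrier G \<Longrightarrow> bij_betw (\<lambda>x. x \<otimes> g) (carrier G) (carrier G)"
  by (rule bij_betw_byWitness[where f' = "\<lambda>x. x \<otimes> inv g"]) (auto simp: m_assoc)

lemma bij_betw_conjugate:
  "g \<in> carrier G \<Longrightarrow> bij_betw (\<lambda>x. g \<otimes> x \<otimes> inv g) (carrier G) (carrier G)"
  using bij_betw_trans[OF bij_betw_translate_left bij_betw_translate_right[of "inv g"], of g]
  by (simp add: o_def)

text \<open>The usual projection of linear maps onto intertwiners, without division by the group
  order. The factor \<open>scaleF 1\<close> gives it the shape of the lemmas on linear
  combinations.\<close>

definition averaged_map ::
    "('a \<Rightarrow> ('c \<Rightarrow> complex) \<Rightarrow> ('c \<Rightarrow> complex)) \<Rightarrow> ('a \<Rightarrow> ('d \<Rightarrow> complex) \<Rightarrow> ('d \<Rightarrow> complex))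
      \<Rightarrow> (('c \<Rightarrow> complex) \<Rightarrow> ('d \<Rightarrow> complex)) \<Rightarrow> ('c \<Rightarrow> complex) \<Rightarrow> ('d \<Rightarrow> complex)"
  where "averaged_map R S f v = (\<Sum>x\<in>carrier G. scaleF 1 ((S x \<circ> (f \<circ> R (inv x))) v))"

lemma averaged_map_linear:
  assumes V: "representation_on G V R" and W: "representation_on G W S"
    and f: "linear_map_on V W f"
  shows "linear_map_on V W (averaged_map R S f)"
  unfolding averaged_map_def[abs_def]
  using representation_onD(3)[OF V] representation_onD(2,3)[OF W] f
  by (intro linear_map_on_combination linear_map_on_compose) auto

text \<open>Left translation by \<open>g\<close> permutes the summands, since (g x)^-1 g =
  x^-1.\<close>

lemma averaged_map_commutes:
  assumes V: "representation_on G V R" and W: "representation_on G W S"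
    and f: "linear_map_on V W f" and g: "g \<in> carrier G" and v: "v \<in> V"
  shows "averaged_map R S f (R g v) = S g (averaged_map R S f v)"
proof -
  note V' = representation_onD[OF V] and W' = representation_onD[OF W]
  have mem: "f (R x v) \<in> W" if "x \<in> carrier G" for x
    using V'(4) linear_map_onD(1)[OF f] that v by blast
  have "S g (averaged_map R S f v) = (\<Sum>x\<in>carrier G. scaleF 1 (S g (S x (f (R (inv x) v)))))"
    unfolding averaged_map_def o_apply
    by (rule linear_map_on_sum[OF W'(3)[OF g] W'(2)]) (simp add: W'(4) mem)
  also have "\<dots> = (\<Sum>x\<in>carrier G. S (g \<otimes> x) (f (R (inv (g \<otimes> x)) (R g v))))"
  proof (rule sum.cong[OF refl])
    fix x assume x: "x \<in> carrier G"
    have "inv (g \<otimes> x) \<otimes> g = inv x"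
      using x g by (simp add: inv_mult_group m_assoc)
    then have "R (inv (g \<otimes> x)) (R g v) = R (inv x) v"
      using V'(6)[of "inv (g \<otimes> x)" g v] x g v by simp
    then show "scaleF 1 (S g (S x (f (R (inv x) v)))) = S (g \<otimes> x) (f (R (inv (g \<otimes> x)) (R g v)))"
      using W'(6)[OF g x] x mem by simp
  qed
  also have "\<dots> = (\<Sum>x\<in>carrier G. S x (f (R (inv x) (R g v))))"
    by (rule sum.reindex_bij_betw[OF bij_betw_translate_left[OF g]])
  also have "\<dots> = averaged_map R S f (R g v)"
    by (simp add: averaged_map_def)
  finally show ?thesis ..
qed

text \<open>By cyclicity R(x) and its inverse cancel. This yields both the trace of an average and
  the invariance of characters under conjugation.\<close>

lemma operator_trace_conjugate:
  assumes V: "representation_on G V R" and f: "linear_map_on V V f" and x: "x \<in> carrier G"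
  shows "operator_trace V (R x \<circ> (f \<circ> R (inv x))) = operator_trace V f"
proof -
  note V' = representation_onD[OF V]
  have "operator_trace V (R x \<circ> (f \<circ> R (inv x))) = operator_trace V ((f \<circ> R (inv x)) \<circ> R x)"
    using x by (intro operator_trace_cyclic[OF V'(1,1)] linear_map_on_compose[OF _ f] V'(3)) auto
  also have "\<dots> = operator_trace V f"
  proof (rule operator_trace_cong[OF V'(2)])
    fix v assume v: "v \<in> V"
    have "R (inv x) (R x v) = v"
      using V'(6)[of "inv x" x v] V'(5) x v by simp
    then show "((f \<circ> R (inv x)) \<circ> R x) v = f v"
      by simp
  qed
  finally show ?thesis .
qed

lemma operator_trace_averaged_map:
  assumes V: "representation_on G V R" and f: "linear_map_on V V f"
  shows "operator_trace V (averaged_map R R f) = of_nat (card (carrier G)) * operator_trace V f"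
proof -
  have "linear_map_on V V (R x \<circ> (f \<circ> R (inv x)))" if "x \<in> carrier G" for x
    using that representation_onD(3)[OF V] f by (intro linear_map_on_compose) auto
  then have "operator_trace V (averaged_map R R f)
      = (\<Sum>x\<in>carrier G. 1 * operator_trace V (R x \<circ> (f \<circ> R (inv x))))"
    unfolding averaged_map_def[abs_def]
    by (rule operator_trace_combination[OF representation_onD(1)[OF V]])
  then show ?thesis
    by (simp add: operator_trace_conjugate[OF V f])
qed

lemma character_of_conjugate:
  assumes V: "representation_on G V R" and g: "g \<in> carrier G" and x: "x \<in> carrier G"
  shows "character_of G V R (x \<otimes> g \<otimes> inv x) = character_of G V R g"
proof -
  note V' = representation_onD[OF V]
  have "operator_trace V (R (x \<otimes> g \<otimes> inv x)) = operator_trace V (R x \<circ> (R g \<circ> R (inv x)))"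
    using g x V' by (intro operator_trace_cong) simp_all
  also have "\<dots> = operator_trace V (R g)"
    by (rule operator_trace_conjugate[OF V V'(3)[OF g] x])
  finally show ?thesis
    using g x by (simp add: character_of_def)
qed

section \<open>Matrix coefficients and orthogonality of characters\<close>

lemma character_of_eq_sum:
  assumes V: "representation_on G V R" and B: "basis_of V B" and x: "x \<in> carrier G"
  shows "character_of G V R x = (\<Sum>b\<in>B. fvs.representation B (R x b) b)"
  using operator_trace_eq[OF _ representation_onD(1)[OF V] B] representation_onD(3)[OF V x] x
  by (simp add: character_of_def linear_operator_on_iff)

text \<open>The map u |-> (b-coordinate of u) c is a matrix unit, and the coefficient shown of its
  average is the sum over x of R(x^-1)_bb S(x)_cc. Orthogonality thereby becomes a statement about
  intertwiners, accessible to Schur's lemma.\<close>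

lemma sum_character_of_mult:
  assumes V: "representation_on G V R" and W: "representation_on G W S"
    and B: "basis_of V B" and C: "basis_of W C"
  shows "(\<Sum>x\<in>carrier G. character_of G V R (inv x) * character_of G W S x)
    = (\<Sum>b\<in>B. \<Sum>c\<in>C. fvs.representation C
        (averaged_map R S (\<lambda>u. scaleF (fvs.representation B u b) c) b) c)"
proof -
  note V' = representation_onD[OF V] and W' = representation_onD[OF W]
  have coeff: "fvs.representation C
        (averaged_map R S (\<lambda>u. scaleF (fvs.representation B u b) c) b) c
      = (\<Sum>x\<in>carrier G. fvs.representation B (R (inv x) b) b * fvs.representation C (S x c) c)"
    if c: "c \<in> C" for b c
  proof -
    have cW: "c \<in> W"
      using c basis_of_subset[OF C] by blast
    have "averaged_map R S (\<lambda>u. scaleF (fvs.representation B u b) c) b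
        = (\<Sum>x\<in>carrier G. scaleF (fvs.representation B (R (inv x) b) b) (S x c))"
      unfolding averaged_map_def using linear_map_onD(3)[OF W'(3)] cW by (intro sum.cong) auto
    then show ?thesis
      using linear_functional_on_sum[OF linear_functional_on_representation[OF C] W'(2),
          of "carrier G" "\<lambda>x. S x c"] W'(4)[OF _ cW] by simp
  qed
  have "(\<Sum>x\<in>carrier G. character_of G V R (inv x) * character_of G W S x)
      = (\<Sum>x\<in>carrier G. \<Sum>b\<in>B. \<Sum>c\<in>C.
          fvs.representation B (R (inv x) b) b * fvs.representation C (S x c) c)"
    using character_of_eq_sum[OF V B] character_of_eq_sum[OF W C]
    by (intro sum.cong refl) (simp add: sum_product)
  also have "\<dots> = (\<Sum>b\<in>B. \<Sum>c\<in>C. \<Sum>x\<in>carrier G.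
          fvs.representation B (R (inv x) b) b * fvs.representation C (S x c) c)"
    by (subst sum.swap, intro sum.cong refl, rule sum.swap)
  finally show ?thesis
    by (simp add: coeff)
qed

text \<open>A nonzero average of a matrix unit would be an isomorphism and would force the
  characters to agree.\<close>

lemma characters_orthogonal:
  assumes V: "irreducible_representation_on G V R" and W: "irreducible_representation_on G W S"
    and neq: "character_of G V R \<noteq> character_of G W S"
  shows "(\<Sum>x\<in>carrier G. character_of G V R (inv x) * character_of G W S x) = 0"
proof -
  note V1 = irreducible_representation_onD(1)[OF V] and W1 = irreducible_representation_onD(1)[OF W]
  note V' = representation_onD[OF V1] and W' = representation_onD[OF W1]
  obtain B where B: "basis_of V B"
    using basis_of_exists[OF V'(2)] .
  obtain C where C: "basis_of W C"
    using basis_of_exists[OF W'(2)] .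
  have "averaged_map R S (\<lambda>u. scaleF (fvs.representation B u b) c) b = 0"
    if "b \<in> B" "c \<in> C" for b c
  proof (rule ccontr)
    let ?f = "\<lambda>u. scaleF (fvs.representation B u b) c"
    assume nz: "averaged_map R S ?f b \<noteq> 0"
    have f: "linear_map_on V W ?f"
      using linear_map_on_rank_one[OF linear_functional_on_representation[OF B] W'(2)]
        basis_of_subset[OF C] that(2) by blast
    have b: "b \<in> V"
      using basis_of_subset[OF B] that(1) by blast
    note F = averaged_map_linear[OF V1 W1 f] and comm = averaged_map_commutes[OF V1 W1 f]
    have "bij_betw (averaged_map R S ?f) V W"
      using comm b nz by (intro schur_bijective[OF V W F, where v = b])
    from character_of_eq_if_isomorphic[OF V1 W1 F this] comm neq show False
      by simp
  qed
  then show ?thesis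
    using C by (simp add: sum_character_of_mult[OF V1 W1 B C] basis_of_def fvs.representation_zero)
qed

text \<open>The average of the matrix unit for (b, c) is a scalar z. Computing its trace in two ways
  gives z * dim V = |G| if b = c and 0 otherwise, so each of the dim V pairs with b = c contributes
  |G| / dim V.\<close>

lemma character_norm:
  assumes V: "irreducible_representation_on G V R"
  shows "(\<Sum>x\<in>carrier G. character_of G V R (inv x) * character_of G V R x) = of_nat (card (carrier G))"
proof -
  note V1 = irreducible_representation_onD(1)[OF V]
  note V' = representation_onD[OF V1]
  obtain B where B: "basis_of V B"
    using basis_of_exists[OF V'(2)] .
  have ind: "fvs.independent B"
    using B by (simp add: basis_of_def)
  have n: "0 < card B"
    using basis_of_card_pos[OF V'(1) B irreducible_representation_onD(2)[OF V]] .
  have fin: "finite B"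
    using basis_of_finite[OF V'(1) B] .
  have "fvs.representation B (averaged_map R R (\<lambda>u. scaleF (fvs.representation B u b) c) b) c
      = (if b = c then of_nat (card (carrier G)) / of_nat (card B) else 0)"
    if bc: "b \<in> B" "c \<in> B" for b c
  proof -
    let ?f = "\<lambda>u. scaleF (fvs.representation B u b) c"
    have V_bc: "b \<in> V" "c \<in> V"
      using basis_of_subset[OF B] bc by auto
    note \<phi> = linear_functional_on_representation[OF B, of b]
    have f: "linear_map_on V V ?f"
      by (rule linear_map_on_rank_one[OF \<phi> V'(2) V_bc(2)])
    obtain z where z: "\<And>v. v \<in> V \<Longrightarrow> averaged_map R R ?f v = scaleF z v"
    proof (rule schur_scalar[OF V averaged_map_linear[OF V1 V1 f]])
      show "averaged_map R R ?f (R g v) = R g (averaged_map R R ?f v)"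
        if "g \<in> carrier G" "v \<in> V" for g v
        by (rule averaged_map_commutes[OF V1 V1 f that])
    qed blast
    have "z * of_nat (card B) = operator_trace V (averaged_map R R ?f)"
      using operator_trace_cong[OF V'(2) z] operator_trace_scale[OF V'(1) B] by simp
    also have "\<dots> = of_nat (card (carrier G)) * fvs.representation B c b"
      by (simp add: operator_trace_averaged_map[OF V1 f] operator_trace_rank_one[OF V'(1) \<phi> V_bc(2)])
    finally have "z = of_nat (card (carrier G)) / of_nat (card B) * (if b = c then 1 else 0)"
      using n by (simp add: fvs.representation_basis[OF ind bc(2)] field_simps split: if_splits)
    moreover have "fvs.representation B (scaleF z b) c = z * (if b = c then 1 else 0)"
      using fvs.representation_scale[OF ind fvs.span_base[OF bc(1)]]
        fvs.representation_basis[OF ind bc(1)] by auto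
    ultimately show ?thesis
      using z[OF V_bc(1)] by simp
  qed
  then show ?thesis
    using n fin by (auto simp: sum_character_of_mult[OF V1 V1 B B])
qed

lemma irreducible_characters_orthonormal:
  assumes "\<phi> \<in> irreducible_characters G" "\<psi> \<in> irreducible_characters G"
  shows "(\<Sum>x\<in>carrier G. \<phi> (inv x) * \<psi> x) = (if \<phi> = \<psi> then of_nat (card (carrier G)) else 0)"
  using assms characters_orthogonal character_norm unfolding irreducible_characters_def by auto

section \<open>Class functions and completeness of the irreducible characters\<close>

lemma irreducible_character_conjugate:
  assumes "\<phi> \<in> irreducible_characters G" "g \<in> carrier G" "x \<in> carrier G"
  shows "\<phi> (x \<otimes> g \<otimes> inv x) = \<phi> g"
  using assms character_of_conjugate irreducible_representation_onD(1)
  unfolding irreducible_characters_def by blast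

text \<open>The action of the group algebra element with coefficients \<open>c\<close>; this element
  is central when \<open>c\<close> is a class function.\<close>

definition class_operator ::
    "('a \<Rightarrow> ('c \<Rightarrow> complex) \<Rightarrow> ('c \<Rightarrow> complex)) \<Rightarrow> ('a \<Rightarrow> complex) \<Rightarrow> ('c \<Rightarrow> complex) \<Rightarrow> ('c \<Rightarrow> complex)"
  where "class_operator R c v = (\<Sum>x\<in>carrier G. scaleF (c x) (R x v))"

lemma class_operator_linear:
  "representation_on G V R \<Longrightarrow> linear_map_on V V (class_operator R c)"
  unfolding class_operator_def[abs_def]
  by (intro linear_map_on_combination) (auto dest: representation_onD(2,3))

text \<open>Substituting g x g^-1 for x leaves the coefficients unchanged and carries R(g) to the
  left.\<close>

lemma class_operator_commutes:
  assumes V: "representation_on G V R"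
    and c: "\<And>g x. g \<in> carrier G \<Longrightarrow> x \<in> carrier G \<Longrightarrow> c (g \<otimes> x \<otimes> inv g) = c x"
    and g: "g \<in> carrier G" and v: "v \<in> V"
  shows "class_operator R c (R g v) = R g (class_operator R c v)"
proof -
  note V' = representation_onD[OF V]
  have "class_operator R c (R g v) = (\<Sum>x\<in>carrier G.
      scaleF (c (g \<otimes> x \<otimes> inv g)) (R (g \<otimes> x \<otimes> inv g) (R g v)))"
    unfolding class_operator_def by (rule sum.reindex_bij_betw[OF bij_betw_conjugate[OF g], symmetric])
  also have "\<dots> = (\<Sum>x\<in>carrier G. scaleF (c x) (R g (R x v)))"
  proof (rule sum.cong[OF refl])
    fix x assume x: "x \<in> carrier G"
    have "R (g \<otimes> x \<otimes> inv g) (R g v) = R (g \<otimes> x \<otimes> inv g \<otimes> g) v"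
      using V'(6)[of "g \<otimes> x \<otimes> inv g" g v] x g v by simp
    also have "g \<otimes> x \<otimes> inv g \<otimes> g = g \<otimes> x"
      using x g by (simp add: m_assoc)
    finally show "scaleF (c (g \<otimes> x \<otimes> inv g)) (R (g \<otimes> x \<otimes> inv g) (R g v)) = scaleF (c x) (R g (R x v))"
      using V'(6)[OF g x v] c[OF g x] by simp
  qed
  also have "\<dots> = R g (class_operator R c v)"
    unfolding class_operator_def
    by (rule linear_map_on_sum[OF V'(3)[OF g] V'(2), symmetric]) (rule V'(4)[OF _ v])
  finally show ?thesis .
qed

text \<open>By Schur's lemma the operator is a scalar; its trace, the scalar times dim V, is the
  pairing of \<open>c\<close> with the character, which is zero.\<close>

lemma class_operator_eq_zero:
  assumes V: "irreducible_representation_on G V R"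
    and c: "\<And>g x. g \<in> carrier G \<Longrightarrow> x \<in> carrier G \<Longrightarrow> c (g \<otimes> x \<otimes> inv g) = c x"
    and orth: "(\<Sum>x\<in>carrier G. c x * character_of G V R x) = 0"
    and v: "v \<in> V"
  shows "class_operator R c v = 0"
proof -
  note V1 = irreducible_representation_onD(1)[OF V]
  note V' = representation_onD[OF V1]
  obtain B where B: "basis_of V B"
    using basis_of_exists[OF V'(2)] .
  obtain z where z: "\<And>v. v \<in> V \<Longrightarrow> class_operator R c v = scaleF z v"
  proof (rule schur_scalar[OF V class_operator_linear[OF V1, of c]])
    show "class_operator R c (R g v) = R g (class_operator R c v)"
      if "g \<in> carrier G" "v \<in> V" for g v
      using class_operator_commutes[where c = c, OF V1 _ that] c by blast
  qed blast
  have "z * of_nat (card B) = operator_trace V (class_operator R c)"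
    using operator_trace_cong[OF V'(2) z] operator_trace_scale[OF V'(1) B] by simp
  also have "\<dots> = (\<Sum>x\<in>carrier G. c x * operator_trace V (R x))"
    unfolding class_operator_def[abs_def] by (rule operator_trace_combination[OF V'(1,3)])
  also have "\<dots> = 0"
    using orth by (simp add: character_of_def)
  finally have "z = 0"
    using basis_of_card_pos[OF V'(1) B irreducible_representation_onD(2)[OF V]] by simp
  then show ?thesis
    using z[OF v] by simp
qed

lemma class_function_eq_zero:
  assumes fin: "finite (carrier G)"
    and c: "\<And>g x. g \<in> carrier G \<Longrightarrow> x \<in> carrier G \<Longrightarrow> c (g \<otimes> x \<otimes> inv g) = c x"
    and orth: "\<And>\<phi>. \<phi> \<in> irreducible_characters G \<Longrightarrow> (\<Sum>x\<in>carrier G. c x * \<phi> x) = 0"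
    and g: "g \<in> carrier G"
  shows "c g = 0"
proof (rule ccontr)
  assume "c g \<noteq> 0"
  \<comment> \<open>The numbering \<open>e\<close> moves the regular representation into
    \<open>nat \<Rightarrow> complex\<close>, where \<open>orth\<close> can be applied to its
    irreducible subspaces.\<close>
  obtain e :: "'a \<Rightarrow> nat" where e: "inj_on e (carrier G)"
    using finite_imp_inj_to_nat_seg[OF fin] by blast
  define d where "d = inv_into (carrier G) e"
  define V :: "(nat \<Rightarrow> complex) set" where "V = {u. \<forall>i. i \<notin> e ` carrier G \<longrightarrow> u i = 0}"
  \<comment> \<open>Right translation transported along \<open>e\<close>; the value 0 off the image
    of \<open>e\<close> keeps the result in \<open>V\<close>.\<close>
  define R where "R h u i = (if i \<in> e ` carrier G then u (e (d i \<otimes> h)) else 0)"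
    for h and u :: "nat \<Rightarrow> complex" and i
  have Re: "R h u (e y) = u (e (y \<otimes> h))" if "y \<in> carrier G" for h u y
    using that e by (simp add: R_def d_def)
  have RV: "R h u \<in> V" for h u
    by (simp add: V_def R_def)
  have eqI: "u = v" if "u \<in> V" "v \<in> V" "\<And>y. y \<in> carrier G \<Longrightarrow> u (e y) = v (e y)" for u v
  proof
    show "u i = v i" for i
      using that by (cases "i \<in> e ` carrier G") (auto simp: V_def)
  qed
  have rep: "representation_on G V R"
    unfolding representation_on_def linear_operator_on_iff
  proof (intro conjI ballI)
    show "finite_dim_subspace V"
      unfolding V_def by (rule finite_dim_subspace_supported) (use fin in simp)
    fix h assume "h \<in> carrier G"
    show "linear_map_on V V (R h)"
      by (rule linear_map_onI[OF RV]) (auto simp: R_def fun_eq_iff scaleF_def)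
  next
    fix v assume "v \<in> V"
    then show "R \<one> v = v"
      using RV by (intro eqI) (simp_all add: Re)
  next
    fix h k v assume "h \<in> carrier G" "k \<in> carrier G" "v \<in> V"
    then show "R (h \<otimes> k) v = R h (R k v)"
      using RV by (intro eqI) (simp_all add: Re m_assoc)
  qed
  note V' = representation_onD[OF rep]
  define A where "A = class_operator R c"
  have A: "linear_map_on V V A"
    unfolding A_def by (rule class_operator_linear[OF rep])
  have A_comm: "A (R h v) = R h (A v)" if "h \<in> carrier G" "v \<in> V" for h v
    unfolding A_def using class_operator_commutes[where c = c, OF rep _ that] c by blast
  have A_e: "A u (e y) = (\<Sum>x\<in>carrier G. c x * u (e (y \<otimes> x)))" if "y \<in> carrier G" for u y
    using that by (simp add: A_def class_operator_def sum_fun_apply scaleF_def Re)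
  \<comment> \<open>The adjoint of \<open>A\<close> for the form \<open>ip\<close> below:
    coefficients are conjugated and translations inverted, since translations are unitary.\<close>
  define A' where "A' v = (\<Sum>x\<in>carrier G. scaleF (cnj (c x)) (R (inv x) v))" for v
  have A'_e: "A' u (e y) = (\<Sum>x\<in>carrier G. cnj (c x) * u (e (y \<otimes> inv x)))"
    if "y \<in> carrier G" for u y
    using that by (simp add: A'_def sum_fun_apply scaleF_def Re)
  have A'V: "A' v \<in> V" for v
    unfolding A'_def by (intro fvs.subspace_sum fvs.subspace_scale V'(2) RV)
  \<comment> \<open>Normality: \<open>A\<close> commutes with every \<open>R (inv x)\<close>, hence
    with their combination \<open>A'\<close>.\<close>
  have A_A': "A (A' v) = A' (A v)" if "v \<in> V" for v
  proof -
    have "A (A' v) = (\<Sum>x\<in>carrier G. scaleF (cnj (c x)) (A (R (inv x) v)))"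
      unfolding A'_def by (rule linear_map_on_sum[OF A V'(2) RV])
    then show ?thesis
      unfolding A'_def using A_comm[OF _ that] by simp
  qed
  define ip where "ip u v = (\<Sum>y\<in>carrier G. u (e y) * cnj (v (e y)))"
    for u v :: "nat \<Rightarrow> complex"
  \<comment> \<open>For each fixed x, the substitution of y x for y moves the translation to the
    second argument.\<close>
  have adj: "ip (A u) v = ip u (A' v)" for u v
  proof -
    have "ip (A u) v = (\<Sum>y\<in>carrier G. \<Sum>x\<in>carrier G. c x * u (e (y \<otimes> x)) * cnj (v (e y)))"
      by (simp add: ip_def A_e sum_distrib_right)
    also have "\<dots> = (\<Sum>x\<in>carrier G. \<Sum>y\<in>carrier G. c x * u (e (y \<otimes> x)) * cnj (v (e y)))"
      by (rule sum.swap)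
    also have "\<dots> = (\<Sum>x\<in>carrier G. \<Sum>y\<in>carrier G. c x * u (e y) * cnj (v (e (y \<otimes> inv x))))"
    proof (rule sum.cong[OF refl])
      fix x assume x: "x \<in> carrier G"
      have "(\<Sum>y\<in>carrier G. c x * u (e (y \<otimes> x)) * cnj (v (e y)))
          = (\<Sum>y\<in>carrier G. c x * u (e (y \<otimes> x)) * cnj (v (e (y \<otimes> x \<otimes> inv x))))"
        using x by (intro sum.cong refl) (simp add: m_assoc)
      also have "\<dots> = (\<Sum>y\<in>carrier G. c x * u (e y) * cnj (v (e (y \<otimes> inv x))))"
        by (rule sum.reindex_bij_betw[OF bij_betw_translate_right[OF x]])
      finally show "(\<Sum>y\<in>carrier G. c x * u (e (y \<otimes> x)) * cnj (v (e y)))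
          = (\<Sum>y\<in>carrier G. c x * u (e y) * cnj (v (e (y \<otimes> inv x))))" .
    qed
    also have "\<dots> = (\<Sum>y\<in>carrier G. \<Sum>x\<in>carrier G. c x * u (e y) * cnj (v (e (y \<otimes> inv x))))"
      by (rule sum.swap)
    also have "\<dots> = ip u (A' v)"
      by (simp add: ip_def A'_e sum_distrib_left mult.assoc mult.left_commute)
    finally show ?thesis .
  qed
  have ip_pos: "u = 0" if "u \<in> V" "ip u u = 0" for u
  proof (rule eqI[OF that(1) fvs.subspace_0[OF V'(2)]])
    have "complex_of_real (\<Sum>y\<in>carrier G. (cmod (u (e y)))\<^sup>2) = 0"
      using that(2) by (simp only: ip_def of_real_sum complex_norm_square)
    then have "(\<Sum>y\<in>carrier G. (cmod (u (e y)))\<^sup>2) = 0"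
      by (simp only: of_real_eq_0_iff)
    then show "u (e y) = 0 (e y)" if "y \<in> carrier G" for y
      using that fin by (simp add: sum_nonneg_eq_0_iff)
  qed
  \<comment> \<open>The point mass at the identity. Its image under \<open>A\<close> takes the value
    \<open>c g\<close> at \<open>e (inv g)\<close>, which shows that \<open>A\<close> is
    nonzero.\<close>
  define \<delta> where "\<delta> i = (if i = e \<one> then 1 else 0 :: complex)" for i
  have \<delta>: "\<delta> \<in> V"
    by (auto simp: V_def \<delta>_def)
  have "A \<delta> (e (inv g)) = (\<Sum>x\<in>carrier G. if x = g then c x else 0)"
    unfolding A_e[OF inv_closed[OF g]]
  proof (rule sum.cong[OF refl])
    fix x assume x: "x \<in> carrier G"
    have "e (inv g \<otimes> x) = e \<one> \<longleftrightarrow> inv g \<otimes> x = \<one>"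
      using e x g by (simp add: inj_on_eq_iff)
    also have "\<dots> \<longleftrightarrow> x = g"
      using x g by (metis inv_solve_left one_closed r_one l_inv)
    finally show "c x * \<delta> (e (inv g \<otimes> x)) = (if x = g then c x else 0)"
      by (simp add: \<delta>_def)
  qed
  then have "A \<delta> \<noteq> 0"
    using \<open>c g \<noteq> 0\<close> fin g by auto
  then have "A ` V \<noteq> {0}"
    using \<delta> by blast
  moreover have "R h u \<in> A ` V" if "h \<in> carrier G" "u \<in> A ` V" for h u
    using that A_comm RV by (metis (no_types, lifting) imageE imageI)
  moreover have "A ` V \<subseteq> V"
    using linear_map_onD(1)[OF A] by blast
  ultimately obtain W where W: "W \<subseteq> A ` V" "irreducible_representation_on G W R"
    using irreducible_subrepresentation_exists[OF rep subspace_linear_map_image[OF A V'(2)]] by metis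
  obtain w where w: "w \<in> W" "w \<noteq> 0"
    using irreducible_representation_onD(2)[OF W(2)]
      fvs.subspace_0[OF representation_onD(2)[OF irreducible_representation_onD(1)[OF W(2)]]] by blast
  obtain v where v: "v \<in> V" "w = A v"
    using w(1) W(1) by blast
  have wV: "w \<in> V"
    using v linear_map_onD(1)[OF A] by blast
  have "character_of G W R \<in> irreducible_characters G"
    using W(2) unfolding irreducible_characters_def by blast
  then have Aw: "A w = 0"
    unfolding A_def using class_operator_eq_zero[where c = c, OF W(2) _ orth w(1)] c by blast
  \<comment> \<open>Normality transfers \<open>A w = 0\<close> to \<open>A' w = 0\<close>, because
    the squared norm of \<open>A' w\<close> is \<open>ip (A' (A w)) w\<close>.\<close>
  have "ip (A' w) (A' w) = ip (A (A' w)) w"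
    by (rule adj[symmetric])
  also have "A (A' w) = 0"
    by (simp only: A_A'[OF wV] Aw) (simp add: A'_def linear_map_on_zero[OF V'(3,2)])
  also have "ip 0 w = 0"
    by (simp add: ip_def)
  finally have "A' w = 0"
    by (rule ip_pos[OF A'V])
  \<comment> \<open>Kernel against image: with w = A v, \<open>ip (A v) w\<close> equals
    \<open>ip v (A' w)\<close>, which is 0.\<close>
  then have "ip w w = 0"
    using adj[of v w] v(2) by (simp add: ip_def)
  then show False
    using ip_pos[OF wV] w(2) by blast
qed

text \<open>The difference of \<open>t\<close> and its proposed expansion is a class function
  orthogonal to all irreducible characters, hence zero.\<close>

lemma class_function_expansion:
  assumes fin: "finite (carrier G)" "finite (irreducible_characters G)"
    and t: "\<And>g x. g \<in> carrier G \<Longrightarrow> x \<in> carrier G \<Longrightarrow> t (g \<otimes> x \<otimes> inv g) = t x"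
    and g: "g \<in> carrier G"
  shows "t g = (\<Sum>\<phi>\<in>irreducible_characters G.
    (1 / of_nat (card (carrier G)) * (\<Sum>x\<in>carrier G. t (inv x) * \<phi> x)) * \<phi> g)"
proof -
  let ?n = "of_nat (card (carrier G)) :: complex"
  define a where "a \<phi> = 1 / ?n * (\<Sum>x\<in>carrier G. t (inv x) * \<phi> x)" for \<phi>
  \<comment> \<open>The difference is composed with inversion so that its pairing with \<psi>
    matches the orthogonality relations; accordingly it is evaluated at
    \<open>inv g\<close>.\<close>
  define c where "c x = t (inv x) - (\<Sum>\<phi>\<in>irreducible_characters G. a \<phi> * \<phi> (inv x))" for x
  have n: "?n \<noteq> 0"
    using fin(1) g by auto
  have "c (inv g) = 0"
  proof (rule class_function_eq_zero[OF fin(1)])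
    fix h x assume hx: "h \<in> carrier G" "x \<in> carrier G"
    have "inv (h \<otimes> x \<otimes> inv h) = h \<otimes> inv x \<otimes> inv h"
      using hx by (simp add: inv_mult_group m_assoc)
    moreover have "(\<Sum>\<phi>\<in>irreducible_characters G. a \<phi> * \<phi> (h \<otimes> inv x \<otimes> inv h))
        = (\<Sum>\<phi>\<in>irreducible_characters G. a \<phi> * \<phi> (inv x))"
      using irreducible_character_conjugate[of _ "inv x" h] hx
      by (intro sum.cong refl arg_cong2[of _ _ _ _ "(*)"]) simp
    ultimately show "c (h \<otimes> x \<otimes> inv h) = c x"
      unfolding c_def using hx t[of h "inv x"] by simp
  next
    fix \<psi> assume \<psi>: "\<psi> \<in> irreducible_characters G"
    have "(\<Sum>x\<in>carrier G. c x * \<psi> x) = (\<Sum>x\<in>carrier G. t (inv x) * \<psi> x)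
        - (\<Sum>x\<in>carrier G. \<Sum>\<phi>\<in>irreducible_characters G. a \<phi> * (\<phi> (inv x) * \<psi> x))"
      by (simp add: c_def left_diff_distrib sum_subtractf sum_distrib_right mult.assoc)
    also have "(\<Sum>x\<in>carrier G. \<Sum>\<phi>\<in>irreducible_characters G. a \<phi> * (\<phi> (inv x) * \<psi> x))
        = (\<Sum>\<phi>\<in>irreducible_characters G. a \<phi> * (\<Sum>x\<in>carrier G. \<phi> (inv x) * \<psi> x))"
      by (subst sum.swap) (simp add: sum_distrib_left)
    also have "\<dots> = (\<Sum>\<phi>\<in>irreducible_characters G. if \<phi> = \<psi> then a \<phi> * ?n else 0)"
      by (intro sum.cong refl) (simp add: irreducible_characters_orthonormal[OF _ \<psi>])
    also have "\<dots> = (\<Sum>x\<in>carrier G. t (inv x) * \<psi> x)"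
      using \<psi> fin(2) n by (simp add: a_def)
    finally show "(\<Sum>x\<in>carrier G. c x * \<psi> x) = 0"
      by simp
  qed (use g in simp)
  then show ?thesis
    using g by (simp add: c_def a_def)
qed

end

section \<open>The twisted trace\<close>

context
  fixes G :: "('a, 'm) monoid_scheme" (structure) and L :: "'a \<Rightarrow> 'a"
  assumes G: "group G" and fin: "finite (carrier G)" and L: "involutive_antiautomorphism G L"
begin

interpretation group G
  by (rule G)

lemma antiautomorphism_bij: "bij_betw L (carrier G) (carrier G)"
  and antiautomorphism_closed: "h \<in> carrier G \<Longrightarrow> L h \<in> carrier G"
  and antiautomorphism_mult: "g \<in> carrier G \<Longrightarrow> h \<in> carrier G \<Longrightarrow> L (g \<otimes> h) = L h \<otimes> L g"
  and antiautomorphism_involutive: "g \<in> carrier G \<Longrightarrow> L (L g) = g"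
  using L unfolding involutive_antiautomorphism_def by (auto dest: bij_betwE)

text \<open>The operator sends f to h |-> f(L(h g)). It is therefore a sum over h of rank-one
  operators f |-> f(L(h g)) \<delta>_h, with traces \<delta>_h(L(h g)).\<close>

lemma operator_trace_twisted_translation:
  assumes g: "g \<in> carrier G"
  shows "operator_trace (L2 G) (right_regular G g \<circ> pullback G L)
    = of_nat (card {h \<in> carrier G. inv h \<otimes> L h = g})"
proof -
  define \<delta> :: "'a \<Rightarrow> 'a \<Rightarrow> complex" where "\<delta> h x = (if x = h then 1 else 0)" for h x
  have V: "finite_dim_subspace (L2 G)"
    unfolding L2_def by (rule finite_dim_subspace_supported[OF fin])
  have sub: "fvs.subspace (L2 G)"
    by (rule finite_dim_subspace_imp_subspace[OF V])
  have \<delta>: "\<delta> h \<in> L2 G" if "h \<in> carrier G" for h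
    using that by (auto simp: L2_def \<delta>_def)
  have \<phi>: "linear_functional_on (L2 G) (\<lambda>f. f (L (h \<otimes> g)))" for h
    by (simp add: linear_functional_on_def scaleF_def)
  have "operator_trace (L2 G) (right_regular G g \<circ> pullback G L)
      = operator_trace (L2 G) (\<lambda>f. \<Sum>h\<in>carrier G. scaleF 1 (scaleF (f (L (h \<otimes> g))) (\<delta> h)))"
  proof (rule operator_trace_cong[OF sub], rule ext)
    fix f :: "'a \<Rightarrow> complex" and x
    show "(right_regular G g \<circ> pullback G L) f x
        = (\<Sum>h\<in>carrier G. scaleF 1 (scaleF (f (L (h \<otimes> g))) (\<delta> h))) x"
      using g fin
      by (simp add: right_regular_def pullback_def sum_fun_apply scaleF_def \<delta>_def
          if_distrib[of "\<lambda>c. _ * c"] cong: if_cong)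
  qed
  also have "\<dots> = (\<Sum>h\<in>carrier G. 1 * operator_trace (L2 G) (\<lambda>f. scaleF (f (L (h \<otimes> g))) (\<delta> h)))"
    by (rule operator_trace_combination[OF V linear_map_on_rank_one[OF \<phi> sub \<delta>]])
  also have "\<dots> = (\<Sum>h\<in>carrier G. \<delta> h (L (h \<otimes> g)))"
    by (simp add: operator_trace_rank_one[OF V \<phi> \<delta>])
  also have "\<dots> = (\<Sum>h\<in>carrier G. if inv h \<otimes> L h = g then 1 else 0)"
  proof (rule sum.cong[OF refl])
    fix h assume h: "h \<in> carrier G"
    \<comment> \<open>Apply \<open>L\<close> to both sides and use that it is an involution.\<close>
    have "L (h \<otimes> g) = h \<longleftrightarrow> h \<otimes> g = L h"
      using antiautomorphism_involutive antiautomorphism_closed h g by (metis m_closed)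
    also have "\<dots> \<longleftrightarrow> inv h \<otimes> L h = g"
      using inv_solve_left'[OF antiautomorphism_closed[OF h] h g] h g antiautomorphism_closed
      by (metis inv_solve_left)
    finally show "\<delta> h (L (h \<otimes> g)) = (if inv h \<otimes> L h = g then 1 else 0)"
      by (simp add: \<delta>_def)
  qed
  also have "\<dots> = of_nat (card {h \<in> carrier G. inv h \<otimes> L h = g})"
    using fin by (simp add: sum.If_cases Int_def)
  finally show ?thesis .
qed

lemma twisted_fibre_card_conjugate:
  assumes k: "k \<in> carrier G" and g: "g \<in> carrier G"
  shows "card {h \<in> carrier G. inv h \<otimes> L h = k \<otimes> g \<otimes> inv k} = card {h \<in> carrier G. inv h \<otimes> L h = g}"
proof -
  \<comment> \<open>L(m h L(m)) = m L(h) L(m), so the inner factor m^-1 m cancels.\<close>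
  have key: "inv (m \<otimes> h \<otimes> L m) \<otimes> L (m \<otimes> h \<otimes> L m) = inv (L m) \<otimes> (inv h \<otimes> L h) \<otimes> L m"
    if "m \<in> carrier G" "h \<in> carrier G" for m h
    using that by (simp add: antiautomorphism_mult antiautomorphism_closed antiautomorphism_involutive
        inv_mult_group m_assoc) (simp add: m_assoc[symmetric] antiautomorphism_closed)
  have Lk: "L (inv k) \<in> carrier G" "L k \<in> carrier G"
    using k antiautomorphism_closed by auto
  have L_one: "L \<one> = \<one>"
    using antiautomorphism_mult[of \<one> \<one>] antiautomorphism_closed[of \<one>] by (simp add: l_cancel_one)
  have L_inv: "L (inv k) = inv (L k)"
    using antiautomorphism_mult[of "inv k" k] L_one k Lk by (metis inv_closed inv_equality inv_inv l_inv)
  \<comment> \<open>\<open>?F\<close> is the substitution of \<open>key\<close> for m = L k, where L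
    m = k; its inverse \<open>?F'\<close> is the one for m = L(k^-1) = (L k)^-1.\<close>
  let ?F = "\<lambda>h. L k \<otimes> h \<otimes> k" and ?F' = "\<lambda>h. inv (L k) \<otimes> h \<otimes> inv k"
  have "bij_betw ?F {h \<in> carrier G. inv h \<otimes> L h = k \<otimes> g \<otimes> inv k} {h \<in> carrier G. inv h \<otimes> L h = g}"
  proof (rule bij_betw_byWitness[where f' = ?F'])
    show "?F ` {h \<in> carrier G. inv h \<otimes> L h = k \<otimes> g \<otimes> inv k} \<subseteq> {h \<in> carrier G. inv h \<otimes> L h = g}"
    proof clarify
      fix h assume h: "h \<in> carrier G" "inv h \<otimes> L h = k \<otimes> g \<otimes> inv k"
      have "inv (?F h) \<otimes> L (?F h) = inv k \<otimes> (k \<otimes> g \<otimes> inv k) \<otimes> k"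
        using key[OF Lk(2) h(1)] h(2) k by (simp add: antiautomorphism_involutive)
      also have "\<dots> = g"
        using k g by (simp add: m_assoc) (simp add: m_assoc[symmetric])
      finally show "?F h \<in> carrier G \<and> inv (?F h) \<otimes> L (?F h) = g"
        using h(1) k Lk by simp
    qed
    show "?F' ` {h \<in> carrier G. inv h \<otimes> L h = g} \<subseteq> {h \<in> carrier G. inv h \<otimes> L h = k \<otimes> g \<otimes> inv k}"
    proof clarify
      fix h assume h: "h \<in> carrier G" "g = inv h \<otimes> L h"
      have "inv (?F' h) \<otimes> L (?F' h) = k \<otimes> (inv h \<otimes> L h) \<otimes> inv k"
        using key[OF Lk(1) h(1)] k by (simp add: antiautomorphism_involutive L_inv[symmetric])
      then show "?F' h \<in> carrier G \<and> inv (?F' h) \<otimes> L (?F' h) = k \<otimes> (inv h \<otimes> L h) \<otimes> inv k"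
        using h(1) k Lk by simp
    qed
  qed (use k Lk in \<open>auto simp: m_assoc, auto simp: m_assoc[symmetric]\<close>)
  then show ?thesis
    by (rule bij_betw_same_card)
qed

text \<open>Counting pairs (x, h) the other way leaves one x for each h, namely L(h)^-1 h. The
  argument \<open>inv x\<close> on the left is the one in the coefficients of
  \<open>class_function_expansion\<close>.\<close>

lemma sum_twisted_fibre_card:
  fixes \<phi> :: "'a \<Rightarrow> complex"
  assumes \<phi>: "\<And>g x. g \<in> carrier G \<Longrightarrow> x \<in> carrier G \<Longrightarrow> \<phi> (x \<otimes> g \<otimes> inv x) = \<phi> g"
  shows "(\<Sum>x\<in>carrier G. of_nat (card {h \<in> carrier G. inv h \<otimes> L h = inv x}) * \<phi> x)
    = (\<Sum>h\<in>carrier G. \<phi> (L h \<otimes> inv h))"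
proof -
  have "(\<Sum>x\<in>carrier G. of_nat (card {h \<in> carrier G. inv h \<otimes> L h = inv x}) * \<phi> x)
      = (\<Sum>x\<in>carrier G. \<Sum>h\<in>carrier G. if inv h \<otimes> L h = inv x then \<phi> x else 0)"
    using fin by (simp add: sum.If_cases Int_def)
  also have "\<dots> = (\<Sum>h\<in>carrier G. \<Sum>x\<in>carrier G. if inv h \<otimes> L h = inv x then \<phi> x else 0)"
    by (rule sum.swap)
  also have "\<dots> = (\<Sum>h\<in>carrier G. \<phi> (inv (L h) \<otimes> h))"
  proof (rule sum.cong[OF refl])
    fix h assume h: "h \<in> carrier G"
    have "inv h \<otimes> L h = inv x \<longleftrightarrow> x = inv (L h) \<otimes> h" if "x \<in> carrier G" for x
      using that h antiautomorphism_closed[OF h] by (metis inv_closed inv_inv inv_mult_group m_closed)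
    then have "(\<Sum>x\<in>carrier G. if inv h \<otimes> L h = inv x then \<phi> x else 0)
        = (\<Sum>x\<in>carrier G. if x = inv (L h) \<otimes> h then \<phi> x else 0)"
      by (intro sum.cong) auto
    then show "(\<Sum>x\<in>carrier G. if inv h \<otimes> L h = inv x then \<phi> x else 0) = \<phi> (inv (L h) \<otimes> h)"
      using fin h antiautomorphism_closed by simp
  qed
  \<comment> \<open>Replacing h by L h turns the argument into h^-1 L(h), which conjugation by h
    carries to L(h) h^-1.\<close>
  also have "\<dots> = (\<Sum>h\<in>carrier G. \<phi> (inv (L (L h)) \<otimes> L h))"
    by (rule sum.reindex_bij_betw[OF antiautomorphism_bij, symmetric])
  also have "\<dots> = (\<Sum>h\<in>carrier G. \<phi> (L h \<otimes> inv h))"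
  proof (rule sum.cong[OF refl])
    fix h assume h: "h \<in> carrier G"
    have "h \<otimes> (inv h \<otimes> L h) \<otimes> inv h = L h \<otimes> inv h"
      using h antiautomorphism_closed[OF h] by (simp add: m_assoc[symmetric])
    then show "\<phi> (inv (L (L h)) \<otimes> L h) = \<phi> (L h \<otimes> inv h)"
      using \<phi>[of "inv h \<otimes> L h" h] h antiautomorphism_closed by (simp add: antiautomorphism_involutive)
  qed
  finally show ?thesis .
qed

end

theorem proposition2:
  fixes G :: "('a, 'm) monoid_scheme" (structure)
    and L :: "'a \<Rightarrow> 'a"
    and \<chi> :: "nat \<Rightarrow> 'a \<Rightarrow> complex"
    and r :: nat
  assumes "group G"
    and "finite (carrier G)"
    and "involutive_antiautomorphism G L"
    and "\<forall>g\<in>carrier G. conjugate_in G (L g) g"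
    and "bij_betw \<chi> {1..r} (irreducible_characters G)"
  shows "\<forall>g\<in>carrier G.
    operator_trace (L2 G) (right_regular G g \<circ> pullback G L) =
      (\<Sum>k=1..r. (1 / of_nat (card (carrier G)) * (\<Sum>h\<in>carrier G. \<chi> k (L h \<otimes> inv h))) * \<chi> k g)"
proof
  fix g assume g: "g \<in> carrier G"
  interpret group G by fact
  define t :: "'a \<Rightarrow> complex" where "t x = of_nat (card {h \<in> carrier G. inv h \<otimes> L h = x})" for x
  define a :: "('a \<Rightarrow> complex) \<Rightarrow> complex"
    where "a \<phi> = 1 / of_nat (card (carrier G)) * (\<Sum>h\<in>carrier G. \<phi> (L h \<otimes> inv h))" for \<phi>
  \<comment> \<open>Finiteness comes from the enumeration by \<chi>, a bijection from
    {1..r}.\<close>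
  have "finite (irreducible_characters G)"
    using assms(5) bij_betw_finite by blast
  moreover have "t (k \<otimes> x \<otimes> inv k) = t x" if "k \<in> carrier G" "x \<in> carrier G" for k x
    unfolding t_def by (simp only: twisted_fibre_card_conjugate[OF assms(1-3) that])
  ultimately have "t g = (\<Sum>\<phi>\<in>irreducible_characters G.
      (1 / of_nat (card (carrier G)) * (\<Sum>x\<in>carrier G. t (inv x) * \<phi> x)) * \<phi> g)"
    using g by (rule class_function_expansion[OF assms(2)])
  also have "\<dots> = (\<Sum>\<phi>\<in>irreducible_characters G. a \<phi> * \<phi> g)"
    unfolding t_def a_def
    using sum_twisted_fibre_card[OF assms(1-3)] irreducible_character_conjugate
    by (intro sum.cong refl) simp
  also have "\<dots> = (\<Sum>k=1..r. a (\<chi> k) * \<chi> k g)"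
    by (rule sum.reindex_bij_betw[OF assms(5), symmetric])
  finally show "operator_trace (L2 G) (right_regular G g \<circ> pullback G L) =
      (\<Sum>k=1..r. (1 / of_nat (card (carrier G)) * (\<Sum>h\<in>carrier G. \<chi> k (L h \<otimes> inv h))) * \<chi> k g)"
    unfolding operator_trace_twisted_translation[OF assms(1-3) g] t_def a_def .
qed

end
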